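(* Assume $-1\in\mathbb F^2$ and let $J=JCK(Z,\delta)$ and $K=Z\oplus Zx\subseteq J$. Then the Lie superalgebra $\mathrm{Der}(J)$ is isomorphic to $\mathcal T(K,\overline{\mathrm{Der}}(K))$, and the Lie superalgebra $\mathrm{Inder}(J)$ is isomorphic to $\mathcal T(K)=\mathcal T(K,\mathrm{Inder}(K))$.
   Context: Let $\mathbb F$ be a field of characteristic $\neq 2$ with $-1\in\mathbb F^2$, $Z$ a unital commutative associative $\mathbb F$-algebra, and $\delta$ a derivation of $Z$ such that $Z\delta(Z)=Z$ (the $\mathbb F$-span of all products $f\delta(g)$, $f,g\in Z$, is $Z$). The Cheng-Kac Jordan superalgebra $J=JCK(Z,\delta)=J_{\bar0}\oplus J_{\bar1}$ is defined as follows: $J_{\bar0}=Z1\oplus Zw_1\oplus Zw_2\oplus Zw_3$ and $J_{\bar1}=Zx\oplus Zx_1\oplus Zx_2\oplus Zx_3$ are free $Z$-modules of rank 4; $J_{\bar0}$ is the $Z$-algebra $(\mathbb F1\oplus\mathbb Fw_1\oplus\mathbb Fw_2\oplus\mathbb Fw_3)\otimes_{\mathbb F}Z$ with $1$ the identity, $w_1^2=w_2^2=1$, $w_3^2=-1$, $w_iw_j=0$ for $i\ne j$. For $f,g\in Z$ and $i,j\in\{1,2,3\}$ the remaining products are: $f(gx)=(fg)x$, $f(gx_j)=(fg)x_j$, $(fw_i)(gx)=(\delta(f)g)x_i$, $(fw_i)(gx_j)=-(fg)x_{i\times j}$, $(fx)(gx)=\delta(f)g-f\delta(g)$, $(fx)(gx_j)=-(fg)w_j$,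 $(fx_i)(gx)=(fg)w_i$, $(fx_i)(gx_j)=0$, extended by supercommutativity ($ab=(-1)^{|a||b|}ba$), where $x_{1\times2}=-x_{2\times1}=x_3$, $x_{1\times3}=-x_{3\times1}=x_2$, $x_{3\times2}=-x_{2\times3}=x_1$, $x_{i\times i}=0$. $K=Z\oplus Zx$ is a subalgebra of $J$. Derivations are super derivations; $D(a,b)$ is $c\mapsto a(bc)-(-1)^{|a||b|}b(ac)$ and $\mathrm{Inder}$ is their span. For $a\in Z$, $\eta_a$ is the odd derivation of $K$ with $\eta_a(Z)=0$, $\eta_a(x)=a$; $\overline{\mathrm{Der}}(K)=\mathrm{Der}(K)_{\bar0}\oplus\{\eta_a:a\in Z\}$, a subalgebra of $\mathrm{Der}(K)$ containing $\mathrm{Inder}(K)$. Tits construction: for a Jordan superalgebra $A$ and a subalgebra $\mathfrak d$ with $\mathrm{Inder}(A)\le\mathfrak d\le\mathrm{Der}(A)$, $\mathcal T(A,\mathfrak d)=(\mathfrak{so}_3\otimes A)\oplus\mathfrak d$, where $\mathfrak{so}_3$ is the Lie algebra of skew-symmetric $3\times3$ matrices over $\mathbb F$, with superanticommutative bracket: $\mathfrak d$ is a subalgebra, $[\partial,M\otimes a]=M\otimes\partial(a)$, and $[M\otimes a,N\otimes b]=[M,N]\otimes ab+\tfrac12\mathrm{trace}(MN)D(a,b)$ for $\partial\in\mathfrak d$, $M,N\in\mathfrak{so}_3$, $a,b\in A$; parity of $M\otimes a$ is that of $a$. $\mathcal T(A)$ denotes $\mathcal T(A,\mathrm{Inder}(A))$.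 *)

theory Defs
  imports Main "HOL-Library.Function_Algebras"
begin

datatype i3 = I1 | I2 | I3

lemma UNIV_i3: "(UNIV :: i3 set) = {I1, I2, I3}"
  using i3.exhaust by blast

instance i3 :: finite
  by standard (simp add: UNIV_i3)

text \<open>Basis of the free Z-module J: 1, w1, w2, w3 (even), x, x1, x2, x3 (odd).\<close>
datatype jb = One | W i3 | X | Xv i3

lemma UNIV_jb: "(UNIV :: jb set) = {One, X} \<union> range W \<union> range Xv"
  by (auto intro: jb.exhaust)

instance jb :: finite
  by standard (simp add: UNIV_jb)

fun odd_b :: "jb \<Rightarrow> bool" where
  "odd_b One = False" | "odd_b (W i) = False" | "odd_b X = True" | "odd_b (Xv i) = True"

text \<open>Elements of J are coefficient vectors \<open>jb \<Rightarrow> 'z\<close>. Parity \<open>False\<close> = even, \<open>True\<close> = odd.\<close>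

definition proj :: "bool \<Rightarrow> (jb \<Rightarrow> 'z::zero) \<Rightarrow> jb \<Rightarrow> 'z" where
  "proj p u = (\<lambda>k. if odd_b k = p then u k else 0)"

definition homog :: "bool \<Rightarrow> (jb \<Rightarrow> 'z::zero) \<Rightarrow> bool" where
  "homog p u \<longleftrightarrow> proj p u = u"

definition single :: "jb \<Rightarrow> 'z::zero \<Rightarrow> jb \<Rightarrow> 'z" where
  "single b f = (\<lambda>k. if k = b then f else 0)"

text \<open>F-scalar multiplication, via the structure map emb : F \<rightarrow> Z of the unital F-algebra Z.\<close>
definition fscal :: "('f \<Rightarrow> 'z::times) \<Rightarrow> 'f \<Rightarrow> ('a \<Rightarrow> 'z) \<Rightarrow> 'a \<Rightarrow> 'z" where
  "fscal emb c u = (\<lambda>k. emb c * u k)"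

fun wsq :: "i3 \<Rightarrow> int" where
  "wsq I1 = 1" | "wsq I2 = 1" | "wsq I3 = -1"

fun xcross :: "i3 \<Rightarrow> i3 \<Rightarrow> 'z::comm_ring_1 \<Rightarrow> jb \<Rightarrow> 'z" where
  "xcross I1 I2 f = single (Xv I3) f"
| "xcross I2 I1 f = single (Xv I3) (- f)"
| "xcross I1 I3 f = single (Xv I2) f"
| "xcross I3 I1 f = single (Xv I2) (- f)"
| "xcross I3 I2 f = single (Xv I1) f"
| "xcross I2 I3 f = single (Xv I1) (- f)"
| "xcross _ _ f = 0"

text \<open>Product of (f b) and (g c) for basis elements b, c (table of the Cheng-Kac superalgebra).\<close>
fun bp :: "('z \<Rightarrow> 'z) \<Rightarrow> jb \<Rightarrow> 'z \<Rightarrow> jb \<Rightarrow> 'z \<Rightarrow> jb \<Rightarrow> 'z::comm_ring_1" where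
  "bp \<delta> One f c g = single c (f * g)"
| "bp \<delta> (W i) f One g = single (W i) (f * g)"
| "bp \<delta> (W i) f (W j) g = (if i = j then single One (of_int (wsq i) * f * g) else 0)"
| "bp \<delta> (W i) f X g = single (Xv i) (\<delta> f * g)"
| "bp \<delta> (W i) f (Xv j) g = - xcross i j (f * g)"
| "bp \<delta> X f One g = single X (f * g)"
| "bp \<delta> X f (W j) g = single (Xv j) (\<delta> g * f)"
| "bp \<delta> X f X g = single One (\<delta> f * g - f * \<delta> g)"
| "bp \<delta> X f (Xv j) g = single (W j) (- (f * g))"
| "bp \<delta> (Xv i) f One g = single (Xv i) (f * g)"
| "bp \<delta> (Xv i) f (W j) g = - xcross j i (g * f)"
| "bp \<delta> (Xv i) f X g = single (W i) (f * g)"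
| "bp \<delta> (Xv i) f (Xv j) g = 0"

definition jmul :: "('z \<Rightarrow> 'z) \<Rightarrow> (jb \<Rightarrow> 'z::comm_ring_1) \<Rightarrow> (jb \<Rightarrow> 'z) \<Rightarrow> jb \<Rightarrow> 'z" where
  "jmul \<delta> u v = (\<Sum>b\<in>UNIV. \<Sum>c\<in>UNIV. bp \<delta> b (u b) c (v c))"

definition Kset :: "(jb \<Rightarrow> 'z::zero) set" where
  "Kset = {u. \<forall>k. k \<notin> {One, X} \<longrightarrow> u k = 0}"

definition ssign :: "bool \<Rightarrow> bool \<Rightarrow> 'a::uminus \<Rightarrow> 'a" where
  "ssign p q v = (if p \<and> q then - v else v)"

definition linmap :: "('f \<Rightarrow> 'z::comm_ring_1) \<Rightarrow> (jb \<Rightarrow> 'z) set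
    \<Rightarrow> ((jb \<Rightarrow> 'z) \<Rightarrow> (jb \<Rightarrow> 'z)) \<Rightarrow> bool" where
  "linmap emb A D \<longleftrightarrow>
     (\<forall>u\<in>A. D u \<in> A) \<and>
     (\<forall>u\<in>A. \<forall>v\<in>A. D (u + v) = D u + D v) \<and>
     (\<forall>c. \<forall>u\<in>A. D (fscal emb c u) = fscal emb c (D u)) \<and>
     (\<forall>u. u \<notin> A \<longrightarrow> D u = 0)"

definition is_sder :: "('f \<Rightarrow> 'z::comm_ring_1) \<Rightarrow> ((jb \<Rightarrow> 'z) \<Rightarrow> (jb \<Rightarrow> 'z) \<Rightarrow> (jb \<Rightarrow> 'z))
    \<Rightarrow> (jb \<Rightarrow> 'z) set \<Rightarrow> bool \<Rightarrow> ((jb \<Rightarrow> 'z) \<Rightarrow> (jb \<Rightarrow> 'z)) \<Rightarrow> bool" where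
  "is_sder emb mul A p D \<longleftrightarrow> linmap emb A D \<and>
     (\<forall>q. \<forall>u\<in>A. homog q u \<longrightarrow> homog (q \<noteq> p) (D u)) \<and>
     (\<forall>q. \<forall>u\<in>A. \<forall>v\<in>A. homog q u \<longrightarrow>
        D (mul u v) = mul (D u) v + ssign p q (mul u (D v)))"

definition Der :: "('f \<Rightarrow> 'z::comm_ring_1) \<Rightarrow> ((jb \<Rightarrow> 'z) \<Rightarrow> (jb \<Rightarrow> 'z) \<Rightarrow> (jb \<Rightarrow> 'z))
    \<Rightarrow> (jb \<Rightarrow> 'z) set \<Rightarrow> ((jb \<Rightarrow> 'z) \<Rightarrow> (jb \<Rightarrow> 'z)) set" where
  "Der emb mul A = {D0 + D1 | D0 D1. is_sder emb mul A False D0 \<and> is_sder emb mul A True D1}"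

definition mproj :: "(jb \<Rightarrow> 'z::comm_ring_1) set \<Rightarrow> bool
    \<Rightarrow> ((jb \<Rightarrow> 'z) \<Rightarrow> (jb \<Rightarrow> 'z)) \<Rightarrow> (jb \<Rightarrow> 'z) \<Rightarrow> (jb \<Rightarrow> 'z)" where
  "mproj A p D = (\<lambda>u. if u \<in> A then proj p (D (proj False u)) + proj (\<not> p) (D (proj True u)) else 0)"

definition super_comm :: "(jb \<Rightarrow> 'z::comm_ring_1) set
    \<Rightarrow> ((jb \<Rightarrow> 'z) \<Rightarrow> (jb \<Rightarrow> 'z)) \<Rightarrow> ((jb \<Rightarrow> 'z) \<Rightarrow> (jb \<Rightarrow> 'z)) \<Rightarrow> (jb \<Rightarrow> 'z) \<Rightarrow> (jb \<Rightarrow> 'z)" where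
  "super_comm A D E = (\<lambda>u. \<Sum>p\<in>UNIV. \<Sum>r\<in>UNIV.
      mproj A p D (mproj A r E u) - ssign p r (mproj A r E (mproj A p D u)))"

definition Dop :: "((jb \<Rightarrow> 'z::comm_ring_1) \<Rightarrow> (jb \<Rightarrow> 'z) \<Rightarrow> (jb \<Rightarrow> 'z)) \<Rightarrow> (jb \<Rightarrow> 'z) set
    \<Rightarrow> (jb \<Rightarrow> 'z) \<Rightarrow> (jb \<Rightarrow> 'z) \<Rightarrow> (jb \<Rightarrow> 'z) \<Rightarrow> (jb \<Rightarrow> 'z)" where
  "Dop mul A a b = (\<lambda>c. if c \<in> A then
      (\<Sum>p\<in>UNIV. \<Sum>q\<in>UNIV. mul (proj p a) (mul (proj q b) c)
                             - ssign p q (mul (proj q b) (mul (proj p a) c)))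
      else 0)"

definition Inder :: "('f \<Rightarrow> 'z::comm_ring_1) \<Rightarrow> ((jb \<Rightarrow> 'z) \<Rightarrow> (jb \<Rightarrow> 'z) \<Rightarrow> (jb \<Rightarrow> 'z))
    \<Rightarrow> (jb \<Rightarrow> 'z) set \<Rightarrow> ((jb \<Rightarrow> 'z) \<Rightarrow> (jb \<Rightarrow> 'z)) set" where
  "Inder emb mul A = {(\<lambda>u. \<Sum>i<n. fscal emb (cs i) (Dop mul A (as i) (bs i) u))
      | (n::nat) cs as bs. \<forall>i<n. as i \<in> A \<and> bs i \<in> A}"

definition eta :: "'z::comm_ring_1 \<Rightarrow> (jb \<Rightarrow> 'z) \<Rightarrow> (jb \<Rightarrow> 'z)" where
  "eta a = (\<lambda>u. if u \<in> Kset then single One (a * u X) else 0)"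

definition DerBarK :: "('f \<Rightarrow> 'z::comm_ring_1) \<Rightarrow> ('z \<Rightarrow> 'z) \<Rightarrow> ((jb \<Rightarrow> 'z) \<Rightarrow> (jb \<Rightarrow> 'z)) set" where
  "DerBarK emb \<delta> = {D0 + eta a | D0 a. is_sder emb (jmul \<delta>) Kset False D0}"

record ('a, 'f) lsa =
  lcar :: "'a set"
  ladd :: "'a \<Rightarrow> 'a \<Rightarrow> 'a"
  lsmul :: "'f \<Rightarrow> 'a \<Rightarrow> 'a"
  lpar :: "bool \<Rightarrow> 'a \<Rightarrow> 'a"
  lbr :: "'a \<Rightarrow> 'a \<Rightarrow> 'a"

definition lsa_iso :: "('a, 'f) lsa \<Rightarrow> ('b, 'f) lsa \<Rightarrow> bool" where
  "lsa_iso L M \<longleftrightarrow> (\<exists>\<phi>. bij_betw \<phi> (lcar L) (lcar M) \<and>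
     (\<forall>x\<in>lcar L. \<forall>y\<in>lcar L. \<phi> (ladd L x y) = ladd M (\<phi> x) (\<phi> y)
                          \<and> \<phi> (lbr L x y) = lbr M (\<phi> x) (\<phi> y)) \<and>
     (\<forall>x\<in>lcar L. \<forall>c p. \<phi> (lsmul L c x) = lsmul M c (\<phi> x) \<and> \<phi> (lpar L p x) = lpar M p (\<phi> x)))"

definition maps_lsa :: "('f \<Rightarrow> 'z::comm_ring_1) \<Rightarrow> (jb \<Rightarrow> 'z) set \<Rightarrow> ((jb \<Rightarrow> 'z) \<Rightarrow> (jb \<Rightarrow> 'z)) set
    \<Rightarrow> ((jb \<Rightarrow> 'z) \<Rightarrow> (jb \<Rightarrow> 'z), 'f) lsa" where
  "maps_lsa emb A S = \<lparr> lcar = S, ladd = (+), lsmul = (\<lambda>c D u. fscal emb c (D u)),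
      lpar = mproj A, lbr = super_comm A \<rparr>"

section \<open>Tits construction T(K, d) = (so_3 \<otimes> K) \<oplus> d\<close>

text \<open>so_3 realised as skew-symmetric 3x3 matrices; basis Eb i. An element of so_3 \<otimes> K is
  written uniquely as \<Sum>_i Eb i \<otimes> m i, hence is represented by \<open>m :: i3 \<Rightarrow> K\<close>.\<close>
definition emat :: "i3 \<Rightarrow> i3 \<Rightarrow> i3 \<Rightarrow> i3 \<Rightarrow> 'f::field" where
  "emat i j = (\<lambda>r s. if r = i \<and> s = j then 1 else 0)"

fun Eb :: "i3 \<Rightarrow> i3 \<Rightarrow> i3 \<Rightarrow> 'f::field" where
  "Eb I1 = emat I2 I3 - emat I3 I2"
| "Eb I2 = emat I3 I1 - emat I1 I3"
| "Eb I3 = emat I1 I2 - emat I2 I1"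

definition mmul :: "(i3 \<Rightarrow> i3 \<Rightarrow> 'f::field) \<Rightarrow> (i3 \<Rightarrow> i3 \<Rightarrow> 'f) \<Rightarrow> i3 \<Rightarrow> i3 \<Rightarrow> 'f" where
  "mmul M N = (\<lambda>r s. \<Sum>t\<in>UNIV. M r t * N t s)"

definition mtrace :: "(i3 \<Rightarrow> i3 \<Rightarrow> 'f::field) \<Rightarrow> 'f" where
  "mtrace M = (\<Sum>r\<in>UNIV. M r r)"

text \<open>Coordinates of a skew-symmetric matrix M = \<Sum>_k so3coord M k \<cdot> Eb k.\<close>
fun so3coord :: "(i3 \<Rightarrow> i3 \<Rightarrow> 'f::field) \<Rightarrow> i3 \<Rightarrow> 'f" where
  "so3coord M I1 = M I2 I3"
| "so3coord M I2 = M I3 I1"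
| "so3coord M I3 = M I1 I2"

definition Tits :: "('f::field \<Rightarrow> 'z::comm_ring_1) \<Rightarrow> ('z \<Rightarrow> 'z) \<Rightarrow> ((jb \<Rightarrow> 'z) \<Rightarrow> (jb \<Rightarrow> 'z)) set
    \<Rightarrow> ((i3 \<Rightarrow> jb \<Rightarrow> 'z) \<times> ((jb \<Rightarrow> 'z) \<Rightarrow> (jb \<Rightarrow> 'z)), 'f) lsa" where
  "Tits emb \<delta> d = \<lparr>
     lcar = {(m, D). (\<forall>i. m i \<in> Kset) \<and> D \<in> d},
     ladd = (\<lambda>(m, D) (n, E). (m + n, D + E)),
     lsmul = (\<lambda>c (m, D). (\<lambda>i. fscal emb c (m i), \<lambda>u. fscal emb c (D u))),
     lpar = (\<lambda>p (m, D). (\<lambda>i. proj p (m i), mproj Kset p D)),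
     lbr = (\<lambda>(m, D) (n, E).
        ((\<lambda>k. \<Sum>i\<in>UNIV. \<Sum>j\<in>UNIV. fscal emb (so3coord (mmul (Eb i) (Eb j) - mmul (Eb j) (Eb i)) k)
                                         (jmul \<delta> (m i) (n j)))
         + (\<lambda>k. D (n k))
         - (\<lambda>k. \<Sum>p\<in>UNIV. \<Sum>q\<in>UNIV. ssign p q (mproj Kset q E (proj p (m k)))),
         (\<Sum>i\<in>UNIV. \<Sum>j\<in>UNIV. (\<lambda>u. fscal emb ((1/2) * mtrace (mmul (Eb i) (Eb j)))
                                         (Dop (jmul \<delta>) Kset (m i) (n j) u)))
         + super_comm Kset D E)) \<rparr>"

end

theory Submission
  imports Defs
begin

text \<open>
  Every superderivation of \<open>J\<close> is determined by its values on \<open>Z\<close>, \<open>w\<^sub>i\<close> and \<open>x\<close>, since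
  \<open>(f w\<^sub>i) (g x) = \<delta>(f) g x\<^sub>i\<close> and \<open>Z \<delta>(Z) = Z\<close>. Solving the Leibniz rule on these generators
  shows that it is described by data \<open>(R, S, c, \<mu>, a)\<close>: two vectors \<open>R, S \<in> Z\<^sup>3\<close>, a scalar
  \<open>c \<in> Z\<close> and an even derivation of \<open>K\<close>, that is, a derivation \<open>\<mu>\<close> of \<open>Z\<close> and \<open>a \<in> Z\<close> with
  \<open>[\<mu>, \<delta>] = 2 a \<delta>\<close>. The same data describe the elements of the Tits superalgebra, with \<open>R\<close> and
  \<open>S\<close> giving \<open>so\<^sub>3 \<otimes> Z\<close> and \<open>so\<^sub>3 \<otimes> Zx\<close>, and \<open>c\<close> giving \<open>\<eta>\<^sub>c\<close>. After rescaling by a square root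
  of \<open>-1\<close>, which turns the form \<open>diag(1, 1, -1)\<close> on the \<open>w\<^sub>i\<close> into the Euclidean one,
  the two brackets agree on the data. Inner derivations are on both sides those with
  \<open>(\<mu>, a) = (2 g \<delta>, - \<delta>(g))\<close> for some \<open>g \<in> Z\<close>.
\<close>

section \<open>Coordinates\<close>

lemma sum_i3: "(\<Sum>i\<in>UNIV. f i) = f I1 + f I2 + (f I3 :: 'a::comm_monoid_add)"
  by (simp add: UNIV_i3 add.assoc)

lemma sum_bool: "(\<Sum>p\<in>UNIV. f p) = f False + (f True :: 'a::comm_monoid_add)"
  by (simp add: UNIV_bool)

lemma sum_jb: "(\<Sum>b\<in>UNIV. f b) = f One + f (W I1) + f (W I2) + f (W I3) + f X
    + f (Xv I1) + f (Xv I2) + (f (Xv I3) :: 'a::comm_monoid_add)"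
proof -
  have eq: "(UNIV :: jb set) = {One, W I1, W I2, W I3, X, Xv I1, Xv I2, Xv I3}"
    by (auto simp: UNIV_jb UNIV_i3)
  show ?thesis unfolding eq by (simp add: add.assoc)
qed

lemma jb_ext:
  assumes "u One = v One" "u (W I1) = v (W I1)" "u (W I2) = v (W I2)" "u (W I3) = v (W I3)"
    "u X = v X" "u (Xv I1) = v (Xv I1)" "u (Xv I2) = v (Xv I2)" "u (Xv I3) = v (Xv I3)"
  shows "u = v"
proof
  fix k show "u k = v k"
  proof (cases k)
    case (W i) then show ?thesis using assms by (cases i) auto
  next
    case (Xv i) then show ?thesis using assms by (cases i) auto
  qed (use assms in auto)
qed

lemma i3_ext: "\<lbrakk>f I1 = g I1; f I2 = g I2; f I3 = g I3\<rbrakk> \<Longrightarrow> f = g"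
  by (rule ext) (metis i3.exhaust)

lemma single_apply: "single b f k = (if k = b then f else 0)"
  by (simp add: single_def)

lemma proj_apply: "proj p u k = (if odd_b k = p then u k else 0)"
  by (simp add: proj_def)

lemma fscal_apply: "fscal e s u k = e s * u k"
  by (simp add: fscal_def)

text \<open>Expanding the double sum over the basis once turns every later identity in
  \<open>J\<close> into eight identities in the commutative ring \<open>Z\<close>. The
  \<open>Xv\<close> coordinates are listed one by one because the cross product on the
  \<open>x_i\<close> is not cyclically symmetric.\<close>

lemma jmul_coords:
  "jmul \<delta> u v One = u One * v One + u (W I1) * v (W I1) + u (W I2) * v (W I2)
     - u (W I3) * v (W I3) + \<delta> (u X) * v X - u X * \<delta> (v X)"
  "jmul \<delta> u v (W i) = u One * v (W i) + u (W i) * v One - u X * v (Xv i) + u (Xv i) * v X"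
  "jmul \<delta> u v X = u One * v X + u X * v One"
  "jmul \<delta> u v (Xv I1) = u One * v (Xv I1) + u (Xv I1) * v One + \<delta> (u (W I1)) * v X
     + \<delta> (v (W I1)) * u X + u (W I2) * v (Xv I3) - u (W I3) * v (Xv I2)
     + v (W I2) * u (Xv I3) - v (W I3) * u (Xv I2)"
  "jmul \<delta> u v (Xv I2) = u One * v (Xv I2) + u (Xv I2) * v One + \<delta> (u (W I2)) * v X
     + \<delta> (v (W I2)) * u X - u (W I1) * v (Xv I3) + u (W I3) * v (Xv I1)
     - v (W I1) * u (Xv I3) + v (W I3) * u (Xv I1)"
  "jmul \<delta> u v (Xv I3) = u One * v (Xv I3) + u (Xv I3) * v One + \<delta> (u (W I3)) * v X
     + \<delta> (v (W I3)) * u X - u (W I1) * v (Xv I2) + u (W I2) * v (Xv I1)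
     - v (W I1) * u (Xv I2) + v (W I2) * u (Xv I1)"
  by (cases i; simp add: jmul_def sum_jb single_def algebra_simps)+

lemma homog_coords:
  assumes "proj q u = u"
  shows "\<not> q \<Longrightarrow> u X = 0" "\<not> q \<Longrightarrow> u (Xv i) = 0" "q \<Longrightarrow> u One = 0" "q \<Longrightarrow> u (W i) = 0"
  using fun_cong[OF assms, of X] fun_cong[OF assms, of "Xv i"]
    fun_cong[OF assms, of One] fun_cong[OF assms, of "W i"]
  by (auto simp: proj_def)

text \<open>The isomorphism is \<open>g\<close> after the inverse of \<open>f\<close>:
  \<open>L\<close> and \<open>M\<close> are each compared with operations on the common parameter
  set \<open>P\<close>. Closure of \<open>P\<close> is what lets \<open>inv_into P f\<close> undo
  \<open>f\<close> on the results.\<close>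

lemma lsa_iso_of_parametrizations:
  assumes f: "bij_betw f P (lcar L)" and g: "bij_betw g P (lcar M)"
    and add: "\<And>p q. p \<in> P \<Longrightarrow> q \<in> P \<Longrightarrow>
      pl p q \<in> P \<and> f (pl p q) = ladd L (f p) (f q) \<and> g (pl p q) = ladd M (g p) (g q)"
    and br: "\<And>p q. p \<in> P \<Longrightarrow> q \<in> P \<Longrightarrow>
      bk p q \<in> P \<and> f (bk p q) = lbr L (f p) (f q) \<and> g (bk p q) = lbr M (g p) (g q)"
    and smul: "\<And>p s. p \<in> P \<Longrightarrow>
      sm s p \<in> P \<and> f (sm s p) = lsmul L s (f p) \<and> g (sm s p) = lsmul M s (g p)"
    and par: "\<And>p b. p \<in> P \<Longrightarrow>
      pr b p \<in> P \<and> f (pr b p) = lpar L b (f p) \<and> g (pr b p) = lpar M b (g p)"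
  shows "lsa_iso L M"
proof -
  let ?h = "inv_into P f"
  have h: "?h (f p) = p" if "p \<in> P" for p
    using f that by (simp add: bij_betw_def inv_into_f_f)
  have cov: "\<exists>p\<in>P. x = f p" if "x \<in> lcar L" for x
    using f that by (auto simp: bij_betw_def)
  have "bij_betw (g \<circ> ?h) (lcar L) (lcar M)"
    by (rule bij_betw_trans[OF bij_betw_inv_into[OF f] g])
  moreover have "(g \<circ> ?h) (ladd L x y) = ladd M ((g \<circ> ?h) x) ((g \<circ> ?h) y)
      \<and> (g \<circ> ?h) (lbr L x y) = lbr M ((g \<circ> ?h) x) ((g \<circ> ?h) y)" if "x \<in> lcar L" "y \<in> lcar L" for x y
  proof -
    obtain p q where pq: "p \<in> P" "q \<in> P" and xy: "x = f p" "y = f q" using cov \<open>x \<in> _\<close> \<open>y \<in> _\<close> by blast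
    have "?h (ladd L x y) = pl p q" "?h (lbr L x y) = bk p q"
      using add[OF pq] br[OF pq] h[of "pl p q"] h[of "bk p q"] xy by auto
    then show ?thesis using add[OF pq] br[OF pq] pq by (simp add: xy h)
  qed
  moreover have "(g \<circ> ?h) (lsmul L s x) = lsmul M s ((g \<circ> ?h) x) \<and> (g \<circ> ?h) (lpar L b x) = lpar M b ((g \<circ> ?h) x)"
    if "x \<in> lcar L" for x s b
  proof -
    obtain p where p: "p \<in> P" and x: "x = f p" using cov \<open>x \<in> _\<close> by blast
    have "?h (lsmul L s x) = sm s p" "?h (lpar L b x) = pr b p"
      using smul[OF p, of s] par[OF p, of b] h[of "sm s p"] h[of "pr b p"] x by auto
    then show ?thesis using smul[OF p, of s] par[OF p, of b] p by (simp add: x h)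
  qed
  ultimately show ?thesis unfolding lsa_iso_def by blast
qed

text \<open>The \<open>R\<close>, \<open>S\<close> and \<open>c\<close> parts are the inner derivations \<open>\<Sum>\<^sub>i D(x, R\<^sub>i x\<^sub>i)\<close>,
  \<open>\<Sum>\<^sub>i D(x, S\<^sub>i w\<^sub>i)\<close> and \<open>D(w\<^sub>1, c x\<^sub>1)\<close>.\<close>

fun J_der :: "('z \<Rightarrow> 'z) \<Rightarrow> (i3 \<Rightarrow> 'z::comm_ring_1) \<Rightarrow> (i3 \<Rightarrow> 'z) \<Rightarrow> 'z \<Rightarrow> ('z \<Rightarrow> 'z) \<Rightarrow> 'z \<Rightarrow> (jb \<Rightarrow> 'z) \<Rightarrow> jb \<Rightarrow> 'z"
  where
  "J_der \<delta> R S c \<mu> a u One = \<mu> (u One) + S I1 * u (Xv I1) + S I2 * u (Xv I2) - S I3 * u (Xv I3) + c * u X"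
| "J_der \<delta> R S c \<mu> a u (W I1) = \<mu> (u (W I1)) + R I2 * u (W I3) - R I3 * u (W I2)
     + S I1 * \<delta> (u X) - \<delta> (S I1) * u X - S I2 * u (Xv I3) + S I3 * u (Xv I2)"
| "J_der \<delta> R S c \<mu> a u (W I2) = \<mu> (u (W I2)) - R I1 * u (W I3) + R I3 * u (W I1)
     + S I2 * \<delta> (u X) - \<delta> (S I2) * u X + S I1 * u (Xv I3) - S I3 * u (Xv I1)"
| "J_der \<delta> R S c \<mu> a u (W I3) = \<mu> (u (W I3)) - R I1 * u (W I2) + R I2 * u (W I1)
     + S I3 * \<delta> (u X) - \<delta> (S I3) * u X + S I1 * u (Xv I2) - S I2 * u (Xv I1)"
| "J_der \<delta> R S c \<mu> a u X = \<mu> (u X) + a * u X + S I1 * u (W I1) + S I2 * u (W I2) - S I3 * u (W I3)"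
| "J_der \<delta> R S c \<mu> a u (Xv I1) = \<mu> (u (Xv I1)) - a * u (Xv I1) + \<delta> (R I1) * u X
     - R I3 * u (Xv I2) + R I2 * u (Xv I3)
     + S I1 * \<delta> (u One) - S I2 * \<delta> (u (W I3)) + S I3 * \<delta> (u (W I2)) - c * u (W I1)"
| "J_der \<delta> R S c \<mu> a u (Xv I2) = \<mu> (u (Xv I2)) - a * u (Xv I2) + \<delta> (R I2) * u X
     - R I1 * u (Xv I3) + R I3 * u (Xv I1)
     + S I2 * \<delta> (u One) + S I1 * \<delta> (u (W I3)) - S I3 * \<delta> (u (W I1)) - c * u (W I2)"
| "J_der \<delta> R S c \<mu> a u (Xv I3) = \<mu> (u (Xv I3)) - a * u (Xv I3) + \<delta> (R I3) * u X
     - R I1 * u (Xv I2) + R I2 * u (Xv I1)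
     + S I3 * \<delta> (u One) + S I1 * \<delta> (u (W I2)) - S I2 * \<delta> (u (W I1)) - c * u (W I3)"

section \<open>Standing hypotheses and the data of derivations\<close>

type_synonym 'z par = "(i3 \<Rightarrow> 'z) \<times> (i3 \<Rightarrow> 'z) \<times> 'z \<times> ('z \<Rightarrow> 'z) \<times> 'z"

locale cheng_kac =
  fixes emb :: "'f::field \<Rightarrow> 'z::comm_ring_1" and \<delta> :: "'z \<Rightarrow> 'z" and \<iota> :: 'f
  assumes char: "(2::'f) \<noteq> 0"
    and sqrt_m1: "\<iota> * \<iota> = -1"
    and emb_one [simp]: "emb 1 = 1"
    and emb_add [simp]: "emb (x + y) = emb x + emb y"
    and emb_mult: "emb (x * y) = emb x * emb y"
    and der_add [simp]: "\<delta> (g + h) = \<delta> g + \<delta> h"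
    and der_scal: "\<delta> (emb x * h) = emb x * \<delta> h"
    and der_leibniz: "\<delta> (g * h) = g * \<delta> h + \<delta> g * h"
    and span: "\<exists>(n::nat) fs gs. z = (\<Sum>i<n. fs i * \<delta> (gs i))"
begin

text \<open>These pairs describe the even derivations of \<open>K\<close>: \<open>\<mu>\<close> acts
  on \<open>Z\<close>, and \<open>x\<close> goes to \<open>a x\<close>. The last clause is
  \<open>[\<mu>, \<delta>] = 2 a \<delta>\<close>, the Leibniz rule for the product
  \<open>(h x) x = \<delta>(h)\<close>.\<close>

definition compatible :: "('z \<Rightarrow> 'z) \<Rightarrow> 'z \<Rightarrow> bool" where
  "compatible \<mu> a \<longleftrightarrow> (\<forall>g h. \<mu> (g + h) = \<mu> g + \<mu> h) \<and> (\<forall>c h. \<mu> (emb c * h) = emb c * \<mu> h) \<and>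
     (\<forall>g h. \<mu> (g * h) = g * \<mu> h + \<mu> g * h) \<and> (\<forall>h. \<mu> (\<delta> h) = \<delta> (\<mu> h) + 2 * a * \<delta> h)"

lemma emb_simps [simp]: "emb 0 = 0" "emb (- x) = - emb x" "emb (x - y) = emb x - emb y"
proof -
  have 0: "emb 0 = 0" using emb_add[of 0 0] by simp
  then show "emb 0 = 0" .
  have 1: "emb (- x) = - emb x" for x using emb_add[of x "- x"] 0 by (simp add: eq_neg_iff_add_eq_0 add.commute)
  then show "emb (- x) = - emb x" .
  show "emb (x - y) = emb x - emb y" using emb_add[of x "- y"] 1 by simp
qed

text \<open>Carries characteristic different from 2 over to \<open>Z\<close>, where cancelling 2
  means multiplying by \<open>emb (1/2)\<close>.\<close>

lemma half: "emb (1/2) * 2 = 1"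
proof -
  have "emb (1/2) * 2 = emb (1/2) * (emb 1 + emb 1)" by simp
  also have "\<dots> = emb ((1/2) * (1 + 1))" by (simp only: emb_add emb_mult)
  also have "\<dots> = 1" using char by simp
  finally show ?thesis .
qed

lemma double_eq_0: "z + z = (0::'z) \<Longrightarrow> z = 0"
  by (metis half mult.assoc mult.left_neutral mult_2 mult_zero_right)

lemma additive_simps:
  fixes \<mu> :: "'z \<Rightarrow> 'z"
  assumes "\<And>g h. \<mu> (g + h) = \<mu> g + \<mu> h"
  shows "\<mu> 0 = 0" "\<mu> (- x) = - \<mu> x" "\<mu> (x - y) = \<mu> x - \<mu> y"
proof -
  have 0: "\<mu> 0 = 0" using assms[of 0 0] by simp
  then show "\<mu> 0 = 0" .
  have 1: "\<mu> (- x) = - \<mu> x" for x using assms[of x "- x"] 0 by (simp add: eq_neg_iff_add_eq_0 add.commute)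
  then show "\<mu> (- x) = - \<mu> x" .
  show "\<mu> (x - y) = \<mu> x - \<mu> y" using assms[of x "- y"] 1 by simp
qed

lemmas der_simps [simp] = additive_simps[OF der_add]

lemma compatibleD:
  assumes "compatible \<mu> a"
  shows "\<mu> (g + h) = \<mu> g + \<mu> h" "\<mu> (emb c * h) = emb c * \<mu> h"
     "\<mu> (g * h) = g * \<mu> h + \<mu> g * h" "\<mu> (\<delta> h) = \<delta> (\<mu> h) + 2 * a * \<delta> h"
     "\<mu> 0 = 0" "\<mu> (- g) = - \<mu> g" "\<mu> (g - h) = \<mu> g - \<mu> h" "\<mu> 1 = 0" "\<mu> (emb c) = 0" "\<mu> 2 = 0"
proof -
  have 1: "\<And>g h. \<mu> (g + h) = \<mu> g + \<mu> h" and 2: "\<And>g h. \<mu> (g * h) = g * \<mu> h + \<mu> g * h"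
    and 3: "\<And>c h. \<mu> (emb c * h) = emb c * \<mu> h"
    using assms by (auto simp: compatible_def)
  have 4: "\<mu> 1 = 0" using 2[of 1 1] by simp
  show "\<mu> (g + h) = \<mu> g + \<mu> h" "\<mu> (emb c * h) = emb c * \<mu> h"
     "\<mu> (g * h) = g * \<mu> h + \<mu> g * h" "\<mu> (\<delta> h) = \<delta> (\<mu> h) + 2 * a * \<delta> h"
    "\<mu> 0 = 0" "\<mu> (- g) = - \<mu> g" "\<mu> (g - h) = \<mu> g - \<mu> h" "\<mu> 1 = 0" "\<mu> (emb c) = 0" "\<mu> 2 = 0"
    using assms additive_simps[OF 1] 4 3[of c 1] 1[of 1 1] by (auto simp: compatible_def)
qed

text \<open>\<open>\<delta>\<close> commutes with itself, so it is compatible with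
  \<open>a = 0\<close> and inherits the consequences of compatibility, such as killing
  constants.\<close>

lemma compatible_der: "compatible \<delta> 0"
  by (simp add: compatible_def der_scal) (simp add: der_leibniz)

lemma der_const [simp]: "\<delta> 1 = 0" "\<delta> (emb c) = 0" "\<delta> 2 = 0"
  using compatibleD[OF compatible_der] by auto

lemma compatible_zero: "compatible (\<lambda>_. 0) 0"
  by (simp add: compatible_def)

abbreviation "JD \<equiv> J_der \<delta>"

text \<open>Compatibility is used where \<open>\<delta>\<close> enters the product, in
  \<open>(f x) (g x)\<close> and \<open>(f w_i) (g x)\<close>: exchanging \<open>\<mu>\<close> and
  \<open>\<delta>\<close> costs \<open>2 a \<delta>\<close>, which the weights \<open>a\<close> on
  \<open>x\<close> and \<open>- a\<close> on each \<open>x_i\<close> balance.\<close>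

lemma J_der_even_sder:
  assumes v: "compatible \<mu> a"
  shows "is_sder emb (jmul \<delta>) UNIV False (JD R 0 0 \<mu> a)"
  unfolding is_sder_def linmap_def homog_def
proof (intro conjI allI ballI impI)
  fix u v c
  note vs = compatibleD[OF assms]
  show "JD R 0 0 \<mu> a (u + v) = JD R 0 0 \<mu> a u + JD R 0 0 \<mu> a v"
    by (rule jb_ext; simp add: vs algebra_simps)
  show "JD R 0 0 \<mu> a (fscal emb c u) = fscal emb c (JD R 0 0 \<mu> a u)"
    by (rule jb_ext; simp add: vs fscal_def algebra_simps)
  show "JD R 0 0 \<mu> a (jmul \<delta> u v) = jmul \<delta> (JD R 0 0 \<mu> a u) v + ssign False q (jmul \<delta> u (JD R 0 0 \<mu> a v))" for q
    by (rule jb_ext; simp add: vs ssign_def jmul_coords der_leibniz algebra_simps)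
next
  fix q and u :: "jb \<Rightarrow> 'z" assume "proj q u = u"
  note * = homog_coords[OF this]
  show "proj (q \<noteq> False) (JD R 0 0 \<mu> a u) = JD R 0 0 \<mu> a u"
    by (cases q; intro jb_ext; simp add: * proj_def compatibleD[OF assms])
qed auto

lemma J_der_odd_sder:
  shows "is_sder emb (jmul \<delta>) UNIV True (JD 0 S c (\<lambda>_. 0) 0)"
  unfolding is_sder_def linmap_def homog_def
proof (intro conjI allI ballI impI)
  fix u v d
  show "JD 0 S c (\<lambda>_. 0) 0 (u + v) = JD 0 S c (\<lambda>_. 0) 0 u + JD 0 S c (\<lambda>_. 0) 0 v"
    by (rule jb_ext; simp add: algebra_simps)
  show "JD 0 S c (\<lambda>_. 0) 0 (fscal emb d u) = fscal emb d (JD 0 S c (\<lambda>_. 0) 0 u)"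
    by (rule jb_ext; simp add: der_scal fscal_def algebra_simps)
next
  fix q and u v :: "jb \<Rightarrow> 'z" assume "proj q u = u"
  note * = homog_coords[OF this]
  show "JD 0 S c (\<lambda>_. 0) 0 (jmul \<delta> u v) = jmul \<delta> (JD 0 S c (\<lambda>_. 0) 0 u) v + ssign True q (jmul \<delta> u (JD 0 S c (\<lambda>_. 0) 0 v))"
    by (cases q; intro jb_ext; simp add: * proj_def ssign_def jmul_coords der_leibniz algebra_simps)
next
  fix q and u :: "jb \<Rightarrow> 'z" assume "proj q u = u"
  note * = homog_coords[OF this]
  show "proj (q \<noteq> True) (JD 0 S c (\<lambda>_. 0) 0 u) = JD 0 S c (\<lambda>_. 0) 0 u"
    by (cases q; intro jb_ext; simp add: * proj_def)
qed auto

section \<open>Classification of the derivations of J\<close>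

lemma J_der_split: "JD R S c \<mu> a = JD R 0 0 \<mu> a + JD 0 S c (\<lambda>_. 0) 0"
  by (rule ext, rule jb_ext; simp)

lemma jmul_single:
  "jmul \<delta> (single One f) (single b g) = single b (f * g)"
  "jmul \<delta> (single (W i) f) (single X g) = single (Xv i) (\<delta> f * g)"
  by (rule jb_ext; cases b; cases i; simp add: jmul_coords single_apply)+

lemma jmul_zero: "jmul \<delta> 0 v = 0" "jmul \<delta> v 0 = 0"
  by (rule jb_ext; simp add: jmul_coords)+

lemma jmul_single_W:
  "jmul \<delta> (single (W i) f) (single (W j) g) = (if i = j then single One (of_int (wsq i) * f * g) else 0)"
  by (rule jb_ext; cases i; cases j; simp add: jmul_coords single_apply)

lemma jb_decomp: "u = single One (u One) + single (W I1) (u (W I1)) + single (W I2) (u (W I2))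
    + single (W I3) (u (W I3)) + single X (u X) + single (Xv I1) (u (Xv I1))
    + single (Xv I2) (u (Xv I2)) + single (Xv I3) (u (Xv I3))" for u :: "jb \<Rightarrow> 'z"
  by (rule jb_ext; simp add: single_def)

lemma sderD:
  assumes "is_sder emb (jmul \<delta>) UNIV p D"
  shows "D (u + v) = D u + D v" "D (fscal emb s u) = fscal emb s (D u)"
    "homog q u \<Longrightarrow> proj (q \<noteq> p) (D u) = D u"
    "homog q u \<Longrightarrow> D (jmul \<delta> u v) = jmul \<delta> (D u) v + ssign p q (jmul \<delta> u (D v))"
    "D 0 = 0"
proof -
  show *: "D (u + v) = D u + D v" for u v using assms by (simp add: is_sder_def linmap_def)
  show "D 0 = 0" using *[of 0 0] by simp
qed (use assms in \<open>auto simp: is_sder_def linmap_def homog_def\<close>)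

lemma homog_single [simp]: "homog q (single b f) \<longleftrightarrow> f = 0 \<or> odd_b b = q"
  by (auto simp: homog_def proj_def single_def fun_eq_iff)

text \<open>An even left factor produces no sign, so this form of the Leibniz rule serves
  derivations of both parities.\<close>

lemma sder_even_mult:
  assumes "is_sder emb (jmul \<delta>) UNIV p D"
  shows "D (jmul \<delta> (single One h) v) = jmul \<delta> (D (single One h)) v + jmul \<delta> (single One h) (D v)"
    and "D (jmul \<delta> (single (W i) h) v) = jmul \<delta> (D (single (W i) h)) v + jmul \<delta> (single (W i) h) (D v)"
  using sderD(4)[OF assms, of False "single One h" v] sderD(4)[OF assms, of False "single (W i) h" v]
  by (simp_all add: ssign_def)

text \<open>\<open>Z\<close>, the \<open>w_i\<close> and \<open>x\<close> generate \<open>J\<close>: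
  the Leibniz rule carries vanishing to \<open>Z w_i\<close> and \<open>Z x\<close>, and then to the
  products \<open>(f w_i) (g x) = \<delta>(f) g x_i\<close>.\<close>

lemma sder_eq_0I:
  assumes D: "is_sder emb (jmul \<delta>) UNIV p D"
    and Z: "\<And>h. D (single One h) = 0" and W: "\<And>i. D (single (W i) 1) = 0" and X: "D (single X 1) = 0"
  shows "D u = 0"
proof -
  note add = sderD(1)[OF D]
  have W': "D (single (W i) h) = 0" for i h
    using sder_even_mult(1)[OF D, of h "single (W i) 1"] by (simp add: jmul_single Z W jmul_zero)
  have X': "D (single X h) = 0" for h
    using sder_even_mult(1)[OF D, of h "single X 1"] by (simp add: jmul_single Z X jmul_zero)
  have 1: "D (single (Xv i) (\<delta> f * g)) = 0" for i f g
    using sder_even_mult(2)[OF D, of i f "single X g"] by (simp add: jmul_single W' X' jmul_zero)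
  have 2: "D (single (Xv i) (\<Sum>j<n. f j * \<delta> (g j))) = 0" for i f g and n :: nat
  proof (induction n)
    case 0
    have "single (Xv i) (0::'z) = 0" by (auto simp: single_def)
    then show ?case by (simp only: lessThan_0 sum.empty sderD(5)[OF D])
  next
    case (Suc n)
    have s: "single (Xv i) (p + q) = single (Xv i) p + single (Xv i) q" for p q :: 'z
      by (auto simp: single_def)
    show ?case
      using 1[of i "g n" "f n"]
      by (simp only: sum.lessThan_Suc s add Suc mult.commute[of "\<delta> (g n)"] add_0)
  qed
  \<comment> \<open>Here \<open>Z \<delta>(Z) = Z\<close> enters: sums of the products above exhaust
    \<open>Z x_i\<close>.\<close>
  have Xv': "D (single (Xv i) h) = 0" for i h
    using span[of h] 2 by metis
  show ?thesis
    by (subst jb_decomp) (simp only: add Z W' X' Xv' add_0)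
qed

lemma sder_diff:
  assumes D: "is_sder emb (jmul \<delta>) UNIV p D" and E: "is_sder emb (jmul \<delta>) UNIV p E"
  shows "is_sder emb (jmul \<delta>) UNIV p (D - E)"
  unfolding is_sder_def linmap_def
proof (intro conjI allI ballI impI)
  fix u v s
  show "(D - E) (u + v) = (D - E) u + (D - E) v"
    by (simp add: sderD[OF D] sderD[OF E])
  show "(D - E) (fscal emb s u) = fscal emb s ((D - E) u)"
    by (simp add: sderD(2)[OF D] sderD(2)[OF E]) (simp add: fscal_def fun_eq_iff algebra_simps)
next
  fix q and u :: "jb \<Rightarrow> 'z" assume h: "homog q u"
  have "proj r (v - w) = proj r v - proj r w" for r and v w :: "jb \<Rightarrow> 'z"
    by (auto simp: proj_def)
  then show "homog (q \<noteq> p) ((D - E) u)"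
    using sderD(3)[OF D h] sderD(3)[OF E h]
    by (simp only: homog_def fun_diff_def[of D E])
next
  fix q and u v :: "jb \<Rightarrow> 'z" assume h: "homog q u"
  have "jmul \<delta> (u - u') v = jmul \<delta> u v - jmul \<delta> u' v" "jmul \<delta> u (v - v') = jmul \<delta> u v - jmul \<delta> u v'" for u u' v v'
    by (rule jb_ext; simp add: jmul_coords algebra_simps)+
  then show "(D - E) (jmul \<delta> u v) = jmul \<delta> ((D - E) u) v + ssign p q (jmul \<delta> u ((D - E) v))"
    by (simp add: sderD(4)[OF D h] sderD(4)[OF E h] ssign_def)
qed auto

text \<open>The data are read off from a few coefficients of \<open>D\<close>, and the corresponding
  \<open>J_der\<close> is subtracted. The difference \<open>E\<close> lacks these coefficients, and
  the relations for \<open>1 1\<close>, \<open>w_i w_j\<close>, \<open>(h w_i) w_j\<close> and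
  \<open>w_i x\<close> force it to vanish on the generators.\<close>

lemma even_sder_J_der:
  assumes D: "is_sder emb (jmul \<delta>) UNIV False D"
  obtains R \<mu> a where "compatible \<mu> a" "D = JD R 0 0 \<mu> a"
proof -
  define \<mu> where "\<mu> = (\<lambda>h. D (single One h) One)"
  define a where "a = D (single X 1) X"
  \<comment> \<open>In \<open>J_der\<close> these coefficients of the images of \<open>w_1\<close>
    and \<open>w_2\<close> are the entries of \<open>R\<close>, the first with a minus sign.\<close>
  define R where "R = (\<lambda>i. case i of I1 \<Rightarrow> - D (single (W I2) 1) (W I3)
     | I2 \<Rightarrow> D (single (W I1) 1) (W I3) | I3 \<Rightarrow> D (single (W I1) 1) (W I2))"
  note parD = homog_coords[OF sderD(3)[OF D]]
  have addO: "single One (g + h) = single One g + single One h" for g h :: 'z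
    by (auto simp: single_def)
  have scO: "single One (emb c * h) = fscal emb c (single One h)" for c h
    by (auto simp: single_def fscal_def)
  have ml: "\<mu> (g * h) = g * \<mu> h + \<mu> g * h" for g h
    using fun_cong[OF sder_even_mult(1)[OF D, of g "single One h"], of One] parD(1)[of False "single One g"]
    by (simp add: jmul_single \<mu>_def) (simp add: jmul_coords single_apply)
  have DX: "D (single X h) X = \<mu> h + a * h" for h
    using fun_cong[OF sder_even_mult(1)[OF D, of h "single X 1"], of X]
    by (simp add: jmul_single \<mu>_def a_def) (simp add: jmul_coords single_apply)
  have xx: "jmul \<delta> (single X h) (single X 1) = single One (\<delta> h)" for h
    by (rule jb_ext; simp add: jmul_coords single_apply)
  have m1: "\<mu> 1 = 0" using ml[of 1 1] by simp
  \<comment> \<open>Leibniz rule for \<open>(h x) x = \<delta>(h)\<close>; the two terms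
    \<open>h \<delta>(a)\<close> cancel and \<open>a \<delta>(h)\<close> appears twice.\<close>
  have md: "\<mu> (\<delta> h) = \<delta> (\<mu> h) + 2 * a * \<delta> h" for h
  proof -
    have "\<mu> (\<delta> h) = (jmul \<delta> (D (single X h)) (single X 1) + jmul \<delta> (single X h) (D (single X 1))) One"
      using sderD(4)[OF D, of True "single X h" "single X 1"] by (simp add: \<mu>_def xx ssign_def)
    also have "\<dots> = \<delta> (\<mu> h) + 2 * a * \<delta> h"
      by (simp add: jmul_coords DX m1) (simp add: single_apply a_def der_leibniz algebra_simps)
    finally show ?thesis .
  qed
  have v: "compatible \<mu> a"
    unfolding compatible_def
  proof (intro conjI allI)
    fix g h c
    show "\<mu> (g + h) = \<mu> g + \<mu> h" by (simp add: \<mu>_def addO sderD(1)[OF D])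
    show "\<mu> (emb c * h) = emb c * \<mu> h"
      unfolding \<mu>_def scO sderD(2)[OF D] by (simp add: fscal_def)
  qed (rule ml, rule md)
  define E where "E = D - JD R 0 0 \<mu> a"
  have E: "is_sder emb (jmul \<delta>) UNIV False E"
    unfolding E_def by (rule sder_diff[OF D J_der_even_sder[OF v]])
  note parE = homog_coords[OF sderD(3)[OF E]]
  have E1: "E (single One h) One = 0" "E (single (W I1) 1) (W I2) = 0" "E (single (W I1) 1) (W I3) = 0"
    "E (single (W I2) 1) (W I3) = 0" "E (single X 1) X = 0" for h
    using compatibleD[OF v] by (simp_all add: E_def \<mu>_def R_def a_def single_apply)
  have EO: "E (single One 1) = 0"
  proof -
    define e where "e = E (single One 1)"
    have e: "e = jmul \<delta> e (single One 1) + jmul \<delta> (single One 1) e"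
      using sder_even_mult(1)[OF E, of 1 "single One 1"] unfolding jmul_single mult_1 e_def .
    have "e (W i) = e (W i) + e (W i)" for i
      by (subst e) (simp add: jmul_coords single_apply)
    then have "E (single One 1) (W i) = 0" for i
      by (simp add: e_def)
    then show ?thesis
      by (intro jb_ext) (simp_all add: E1 parE[of False])
  qed
  have sO: "single One (0::'z) = 0" "single One (-1::'z) = - single One 1"
    by (auto simp: single_def)
  have Em: "E (- u) = - E u" for u
    using sderD(1)[OF E, of u "- u"] sderD(5)[OF E] by (simp add: eq_neg_iff_add_eq_0 add.commute)
  \<comment> \<open>\<open>w_i w_j\<close> is \<open>0\<close>, \<open>1\<close> or
    \<open>- 1\<close>, and \<open>E\<close> kills all three.\<close>
  have WW: "jmul \<delta> (E (single (W i) 1)) (single (W j) 1) + jmul \<delta> (single (W i) 1) (E (single (W j) 1)) = 0" for i j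
    using sder_even_mult(2)[OF E, of i 1 "single (W j) 1"]
    by (cases i) (simp_all add: jmul_single_W EO sO Em sderD(5)[OF E] split: if_splits)
  have EW: "E (single (W i) 1) = 0" for i
  proof -
    have 1: "E (single (W i) 1) One = 0" for i
      by (rule double_eq_0) (use fun_cong[OF WW[of i i], of "W i"] in \<open>simp add: jmul_coords single_apply\<close>)
    have 2: "E (single (W i) 1) (W i) = 0" for i
      by (rule double_eq_0) (use fun_cong[OF WW[of i i], of One] in \<open>cases i; simp add: jmul_coords single_apply\<close>)
    \<comment> \<open>On the \<open>w_i\<close>, \<open>E\<close> is skew for the form
      \<open>diag(1, 1, -1)\<close>; the entries on one side of the diagonal were removed by the
      choice of \<open>R\<close>, so those on the other side vanish too.\<close>
    have "E (single (W I2) 1) (W I1) = 0" "E (single (W I3) 1) (W I1) = 0" "E (single (W I3) 1) (W I2) = 0"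
      using fun_cong[OF WW[of I1 I2], of One] fun_cong[OF WW[of I1 I3], of One] fun_cong[OF WW[of I2 I3], of One]
      by (simp_all add: jmul_coords single_apply E1)
    then have "E (single (W i) 1) (W j) = 0" for j
      by (cases i; cases j) (simp_all add: E1 2)
    with 1 show ?thesis
      by (intro jb_ext) (simp_all add: parE[of False])
  qed
  have EhW: "E (single (W i) h) = jmul \<delta> (E (single One h)) (single (W i) 1)" for i h
    using sder_even_mult(1)[OF E, of h "single (W i) 1"] by (simp add: jmul_single EW jmul_zero)
  have EZ: "E (single One h) = 0" for h
  proof -
    have c: "E (single One h) (W i) = 0" for i
    proof -
      \<comment> \<open>\<open>(h w_i) w_j = 0\<close> for \<open>j \<noteq> i\<close>. After
        applying \<open>E\<close>, the \<open>w_j\<close> coordinate is, up to sign, the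
        \<open>w_i\<close> coordinate of \<open>E(h)\<close>.\<close>
      obtain j where "i \<noteq> j" by (metis i3.distinct(1))
      then have "jmul \<delta> (jmul \<delta> (E (single One h)) (single (W i) 1)) (single (W j) 1) = 0"
        using sder_even_mult(2)[OF E, of i h "single (W j) 1"]
        by (simp add: jmul_single_W EhW[of i h] EW jmul_zero sderD(5)[OF E])
      from fun_cong[OF this, of "W j"] \<open>i \<noteq> j\<close> show ?thesis
        by (cases i; cases j) (simp_all add: jmul_coords single_apply)
    qed
    show ?thesis by (intro jb_ext) (simp_all add: parE[of False] E1 c)
  qed
  have EX: "E (single X 1) = 0"
  proof -
    \<comment> \<open>\<open>w_i x = \<delta>(1) x_i = 0\<close>, so every \<open>w_i\<close>
      annihilates \<open>E(x)\<close>; three coordinates of these relations are its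
      \<open>x_j\<close> coefficients up to sign.\<close>
    have "jmul \<delta> (single (W i) 1) (E (single X 1)) = 0" for i
    proof -
      have "single (Xv i) (0::'z) = 0" by (auto simp: single_def)
      then show ?thesis
        using sder_even_mult(2)[OF E, of i 1 "single X 1"] by (simp add: jmul_single EW jmul_zero sderD(5)[OF E])
    qed
    note w = fun_cong[OF this]
    show ?thesis
      using w[of I1 "Xv I2"] w[of I1 "Xv I3"] w[of I2 "Xv I3"]
      by (intro jb_ext) (simp_all add: parE[of True] E1 jmul_coords single_apply)
  qed
  have "E u = 0" for u by (rule sder_eq_0I[OF E EZ EW EX])
  then have "D = JD R 0 0 \<mu> a" by (auto simp: E_def fun_eq_iff)
  with v show ?thesis by (rule that)
qed

text \<open>The scheme is that of the even case. The relations among the \<open>w_i\<close> now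
  leave one unknown, \<open>E(w_i) = q x_i\<close> with a common \<open>q\<close>, which the
  relation \<open>w_i x = 0\<close> removes.\<close>

lemma odd_sder_J_der:
  assumes D: "is_sder emb (jmul \<delta>) UNIV True D"
  obtains S c where "D = JD 0 S c (\<lambda>_. 0) 0"
proof -
  define c where "c = D (single X 1) One"
  define S where "S = (\<lambda>i. case i of I1 \<Rightarrow> D (single (W I1) 1) X
     | I2 \<Rightarrow> D (single (W I2) 1) X | I3 \<Rightarrow> - D (single (W I3) 1) X)"
  define E where "E = D - JD 0 S c (\<lambda>_. 0) 0"
  have E: "is_sder emb (jmul \<delta>) UNIV True E"
    unfolding E_def by (rule sder_diff[OF D J_der_odd_sder])
  note parE = homog_coords[OF sderD(3)[OF E]]
  have E1: "E (single (W i) 1) X = 0" "E (single X 1) One = 0" for i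
    by (cases i) (simp_all add: E_def S_def c_def single_apply)
  have EO: "E (single One 1) = 0"
  proof -
    define e where "e = E (single One 1)"
    have e: "e = jmul \<delta> e (single One 1) + jmul \<delta> (single One 1) e"
      using sder_even_mult(1)[OF E, of 1 "single One 1"] unfolding jmul_single mult_1 e_def .
    have "e X = e X + e X"
      by (subst e) (simp add: jmul_coords single_apply)
    moreover have "e (Xv i) = e (Xv i) + e (Xv i)" for i
      by (subst e) (cases i; simp add: jmul_coords single_apply)
    ultimately have "E (single One 1) X = 0" "E (single One 1) (Xv i) = 0" for i
      by (simp_all add: e_def)
    then show ?thesis
      by (intro jb_ext) (simp_all add: parE[of False])
  qed
  have sO: "single One (0::'z) = 0" "single One (-1::'z) = - single One 1"
    by (auto simp: single_def)
  have Em: "E (- u) = - E u" for u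
    using sderD(1)[OF E, of u "- u"] sderD(5)[OF E] by (simp add: eq_neg_iff_add_eq_0 add.commute)
  have WW: "jmul \<delta> (E (single (W i) 1)) (single (W j) 1) + jmul \<delta> (single (W i) 1) (E (single (W j) 1)) = 0" for i j
    using sder_even_mult(2)[OF E, of i 1 "single (W j) 1"]
    by (cases i) (simp_all add: jmul_single_W EO sO Em sderD(5)[OF E] split: if_splits)
  \<comment> \<open>The relations for \<open>w_i^2\<close> kill the other \<open>x_j\<close>
    coefficients of \<open>E(w_i)\<close>; those for \<open>w_1 w_2\<close> and
    \<open>w_1 w_3\<close> make the remaining ones equal.\<close>
  define q where "q = E (single (W I1) 1) (Xv I1)"
  have EW: "E (single (W i) 1) = single (Xv i) q" for i
  proof -
    have "E (single (W i) 1) (Xv j) = 0" if "i \<noteq> j" for j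
      by (rule double_eq_0) (use that fun_cong[OF WW[of i i], of "Xv I1"] fun_cong[OF WW[of i i], of "Xv I2"] fun_cong[OF WW[of i i], of "Xv I3"] in \<open>cases i; cases j; simp add: jmul_coords single_apply\<close>)
    moreover have "E (single (W i) 1) (Xv i) = q"
      using fun_cong[OF WW[of I1 I2], of "Xv I3"] fun_cong[OF WW[of I1 I3], of "Xv I2"]
      by (cases i) (simp_all add: q_def jmul_coords single_apply)
    ultimately show ?thesis
      by (intro jb_ext) (simp_all add: parE[of False] E1, (cases i; simp add: single_apply)+)
  qed
  have EhW: "E (single (W i) h) = jmul \<delta> (E (single One h)) (single (W i) 1) + single (Xv i) (h * q)" for i h
    using sder_even_mult(1)[OF E, of h "single (W i) 1"] by (simp add: jmul_single EW)
  have EZ: "E (single One h) = 0" for h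
  proof -
    have c: "E (single One h) (Xv j) = 0" for j
    proof -
      \<comment> \<open>Multiplying \<open>x_j\<close> by \<open>w_i\<close> and then by
        \<open>w_j\<close> gives plus or minus \<open>x_i\<close>, while the terms with
        \<open>q\<close> are multiples of \<open>x_k\<close>. The \<open>x_i\<close> coordinate thus
        isolates the \<open>x_j\<close> coefficient of \<open>E(h)\<close>.\<close>
      obtain i k where ik: "i \<noteq> j" "k \<noteq> j" "i \<noteq> k" by (metis i3.distinct(1,3,5) i3.exhaust)
      then have "jmul \<delta> (E (single (W i) h)) (single (W j) 1) + jmul \<delta> (single (W i) h) (E (single (W j) 1)) = 0"
        using sder_even_mult(2)[OF E, of i h "single (W j) 1"]
        by (simp add: jmul_single_W sderD(5)[OF E])
      from fun_cong[OF this, of "Xv i"] ik show ?thesis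
        unfolding EhW EW
        by (cases i; cases j; cases k) (simp_all add: jmul_coords single_apply)
    qed
    \<comment> \<open>\<open>h = (h w_1) w_1\<close>, and a product with a multiple of
      \<open>w_1\<close> has no \<open>x\<close> coordinate.\<close>
    have "E (single One h) X = 0"
      using fun_cong[OF sder_even_mult(2)[OF E, of I1 h "single (W I1) 1"], of X]
      by (simp add: jmul_single_W EhW EW) (simp add: jmul_coords single_apply)
    then show ?thesis by (intro jb_ext) (simp_all add: parE[of False] c)
  qed
  have wx: "jmul \<delta> (single (Xv i) q) (single X 1) + jmul \<delta> (single (W i) 1) (E (single X 1)) = 0" for i
  proof -
    have "single (Xv i) (0::'z) = 0" by (auto simp: single_def)
    then show ?thesis
      using sder_even_mult(2)[OF E, of i 1 "single X 1"] by (simp add: jmul_single EW sderD(5)[OF E])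
  qed
  \<comment> \<open>The other contribution to the \<open>w_1\<close> coordinate is the coefficient
    of \<open>1\<close> in \<open>E(x)\<close>, which is zero by the choice of
    \<open>c\<close>.\<close>
  have q: "q = 0"
    using fun_cong[OF wx[of I1], of "W I1"] by (simp add: jmul_coords single_apply E1)
  have EX: "E (single X 1) = 0"
    using fun_cong[OF wx[of I1], of One] fun_cong[OF wx[of I2], of One] fun_cong[OF wx[of I3], of One]
    by (intro jb_ext) (simp_all add: parE[of True] E1 jmul_coords single_apply)
  have EW0: "E (single (W i) 1) = 0" for i
    by (rule ext) (simp add: EW q single_apply)
  have "E u = 0" for u by (rule sder_eq_0I[OF E EZ EW0 EX])
  then have "D = JD 0 S c (\<lambda>_. 0) 0" by (auto simp: E_def fun_eq_iff)
  then show ?thesis by (rule that)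
qed

lemma Der_J: "Der emb (jmul \<delta>) UNIV = {JD R S c \<mu> a | R S c \<mu> a. compatible \<mu> a}"
proof (intro equalityI subsetI)
  fix D assume "D \<in> Der emb (jmul \<delta>) UNIV"
  then obtain D0 D1 where D: "D = D0 + D1" and D0: "is_sder emb (jmul \<delta>) UNIV False D0"
    and D1: "is_sder emb (jmul \<delta>) UNIV True D1"
    by (auto simp: Der_def)
  from D0 obtain R \<mu> a where v: "compatible \<mu> a" and "D0 = JD R 0 0 \<mu> a"
    by (rule even_sder_J_der)
  moreover from D1 obtain S c where "D1 = JD 0 S c (\<lambda>_. 0) 0"
    by (rule odd_sder_J_der)
  ultimately have "D = JD R S c \<mu> a" unfolding D by (simp only: J_der_split[of R S c \<mu> a])
  with v show "D \<in> {JD R S c \<mu> a | R S c \<mu> a. compatible \<mu> a}" by blast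
next
  fix D assume "D \<in> {JD R S c \<mu> a | R S c \<mu> a. compatible \<mu> a}"
  then obtain R S c \<mu> a where D: "D = JD R S c \<mu> a" and v: "compatible \<mu> a" by auto
  show "D \<in> Der emb (jmul \<delta>) UNIV"
    unfolding Der_def mem_Collect_eq D
    by (intro exI conjI, rule J_der_split, rule J_der_even_sder[OF v], rule J_der_odd_sder)
qed

text \<open>All data are visible in the images of \<open>Z\<close>, \<open>w_i\<close> and
  \<open>x\<close>; compatibility supplies \<open>\<mu> 1 = 0\<close>, so that \<open>\<mu>\<close>
  does not disturb the coefficients of \<open>w_i\<close> and \<open>x\<close>.\<close>

lemma J_der_inject:
  assumes "compatible \<mu> a" "compatible \<mu>' a'" "JD R S c \<mu> a = JD R' S' c' \<mu>' a'"
  shows "R = R' \<and> S = S' \<and> c = c' \<and> \<mu> = \<mu>' \<and> a = a'"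
proof -
  note vs = compatibleD[OF assms(1)] compatibleD[OF assms(2)]
  have e: "JD R S c \<mu> a u k = JD R' S' c' \<mu>' a' u k" for u k using assms(3) by simp
  have "\<mu> = \<mu>'" using e[of "single One _" One] by (simp add: single_def fun_eq_iff)
  moreover have "c = c'" "a = a'"
    using e[of "single X 1" One] e[of "single X 1" X] by (simp_all add: single_def vs)
  moreover have "S = S'"
    using e[of "single (W I1) 1" X] e[of "single (W I2) 1" X] e[of "single (W I3) 1" X]
    by (intro i3_ext) (simp_all add: single_def vs)
  moreover have "R = R'"
    using e[of "single (W I1) 1" "W I2"] e[of "single (W I1) 1" "W I3"] e[of "single (W I2) 1" "W I3"]
    by (intro i3_ext) (simp_all add: single_def vs)
  ultimately show ?thesis by simp
qed

section \<open>Linear operations, grading and superbracket on the data\<close>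

lemma J_der_add:
  "JD R S c \<mu> a + JD R' S' c' \<mu>' a' = JD (R + R') (S + S') (c + c') (\<mu> + \<mu>') (a + a')"
  by (rule ext, rule jb_ext; simp add: algebra_simps)

lemma J_der_scal:
  "(\<lambda>u. fscal emb s (JD R S c \<mu> a u))
    = JD (\<lambda>i. emb s * R i) (\<lambda>i. emb s * S i) (emb s * c) (\<lambda>h. emb s * \<mu> h) (emb s * a)"
  by (rule ext, rule jb_ext; simp add: fscal_def der_leibniz algebra_simps)

lemma J_der_mproj:
  assumes "compatible \<mu> a"
  shows "mproj UNIV p (JD R S c \<mu> a) = (if p then JD 0 S c (\<lambda>_. 0) 0 else JD R 0 0 \<mu> a)"
  by (cases p; simp; intro ext[where f = "mproj _ _ _"] jb_ext;
      simp add: mproj_def proj_def compatibleD[OF assms])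

text \<open>The signs that set \<open>I3\<close> apart in the bracket come from \<open>w\<^sub>3\<^sup>2 = -1\<close>.\<close>

definition br_R :: "(i3 \<Rightarrow> 'z) \<Rightarrow> (i3 \<Rightarrow> 'z) \<Rightarrow> 'z \<Rightarrow> ('z \<Rightarrow> 'z) \<Rightarrow> (i3 \<Rightarrow> 'z) \<Rightarrow> (i3 \<Rightarrow> 'z) \<Rightarrow> 'z \<Rightarrow> ('z \<Rightarrow> 'z) \<Rightarrow> i3 \<Rightarrow> 'z" where
  "br_R R S c \<mu> R' S' c' \<mu>' k = \<mu> (R' k) - \<mu>' (R k) + c * S' k + c' * S k + (case k of
      I1 \<Rightarrow> R I2 * R' I3 - R I3 * R' I2 - (\<delta> (S I2) * S' I3 - S I2 * \<delta> (S' I3)) + (\<delta> (S I3) * S' I2 - S I3 * \<delta> (S' I2))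
    | I2 \<Rightarrow> R I3 * R' I1 - R I1 * R' I3 - (\<delta> (S I3) * S' I1 - S I3 * \<delta> (S' I1)) + (\<delta> (S I1) * S' I3 - S I1 * \<delta> (S' I3))
    | I3 \<Rightarrow> R I2 * R' I1 - R I1 * R' I2 + (\<delta> (S I1) * S' I2 - S I1 * \<delta> (S' I2)) - (\<delta> (S I2) * S' I1 - S I2 * \<delta> (S' I1)))"

definition br_S :: "(i3 \<Rightarrow> 'z) \<Rightarrow> (i3 \<Rightarrow> 'z) \<Rightarrow> ('z \<Rightarrow> 'z) \<Rightarrow> 'z \<Rightarrow> (i3 \<Rightarrow> 'z) \<Rightarrow> (i3 \<Rightarrow> 'z) \<Rightarrow> ('z \<Rightarrow> 'z) \<Rightarrow> 'z \<Rightarrow> i3 \<Rightarrow> 'z" where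
  "br_S R S \<mu> a R' S' \<mu>' a' k = \<mu> (S' k) + a * S' k - \<mu>' (S k) - a' * S k + (case k of
      I1 \<Rightarrow> R I2 * S' I3 - R I3 * S' I2 - R' I2 * S I3 + R' I3 * S I2
    | I2 \<Rightarrow> R I3 * S' I1 - R I1 * S' I3 - R' I3 * S I1 + R' I1 * S I3
    | I3 \<Rightarrow> R I2 * S' I1 - R I1 * S' I2 - R' I2 * S I1 + R' I1 * S I2)"

definition br_c :: "(i3 \<Rightarrow> 'z) \<Rightarrow> (i3 \<Rightarrow> 'z) \<Rightarrow> 'z \<Rightarrow> ('z \<Rightarrow> 'z) \<Rightarrow> 'z \<Rightarrow> (i3 \<Rightarrow> 'z) \<Rightarrow> (i3 \<Rightarrow> 'z) \<Rightarrow> 'z \<Rightarrow> ('z \<Rightarrow> 'z) \<Rightarrow> 'z \<Rightarrow> 'z" where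
  "br_c R S c \<mu> a R' S' c' \<mu>' a' = \<mu> c' - a * c' - \<mu>' c + a' * c
     - \<delta> (R I1) * S' I1 - \<delta> (R I2) * S' I2 + \<delta> (R I3) * S' I3
     + \<delta> (R' I1) * S I1 + \<delta> (R' I2) * S I2 - \<delta> (R' I3) * S I3"

text \<open>The form given by the squares \<open>w_i^2\<close>. Odd data \<open>S\<close>,
  \<open>S'\<close> contribute to a bracket the pair of \<open>compatible_inner\<close> with
  \<open>g = dotS S S'\<close>.\<close>

definition dotS :: "(i3 \<Rightarrow> 'z) \<Rightarrow> (i3 \<Rightarrow> 'z) \<Rightarrow> 'z" where
  "dotS S S' = S I1 * S' I1 + S I2 * S' I2 - S I3 * S' I3"

definition br_mu :: "(i3 \<Rightarrow> 'z) \<Rightarrow> ('z \<Rightarrow> 'z) \<Rightarrow> (i3 \<Rightarrow> 'z) \<Rightarrow> ('z \<Rightarrow> 'z) \<Rightarrow> 'z \<Rightarrow> 'z" where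
  "br_mu S \<mu> S' \<mu>' = (\<lambda>h. \<mu> (\<mu>' h) - \<mu>' (\<mu> h) + 2 * dotS S S' * \<delta> h)"

definition br_a :: "(i3 \<Rightarrow> 'z) \<Rightarrow> ('z \<Rightarrow> 'z) \<Rightarrow> 'z \<Rightarrow> (i3 \<Rightarrow> 'z) \<Rightarrow> ('z \<Rightarrow> 'z) \<Rightarrow> 'z \<Rightarrow> 'z" where
  "br_a S \<mu> a S' \<mu>' a' = \<mu> a' - \<mu>' a - \<delta> (dotS S S')"

lemmas br_defs = br_R_def br_S_def br_c_def br_mu_def br_a_def dotS_def

lemma compatible_add:
  assumes v: "compatible \<mu> a" and v': "compatible \<mu>' a'"
  shows "compatible (\<mu> + \<mu>') (a + a')"
  unfolding compatible_def
  by (intro conjI allI; simp add: compatibleD[OF v] compatibleD[OF v'] algebra_simps)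

lemma compatible_scal:
  assumes v: "compatible \<mu> a"
  shows "compatible (\<lambda>h. emb s * \<mu> h) (emb s * a)"
  unfolding compatible_def
  by (intro conjI allI; simp add: compatibleD[OF v] der_leibniz algebra_simps)

text \<open>\<open>[2 g \<delta>, \<delta>] = - 2 \<delta>(g) \<delta>\<close>, which dictates the
  second component. In \<open>J\<close> and in \<open>K\<close> this pair comes from
  \<open>D(- g x, x)\<close>.\<close>

lemma compatible_inner: "compatible (\<lambda>h. 2 * g * \<delta> h) (- \<delta> g)"
  by (simp add: compatible_def der_leibniz algebra_simps)

lemma J_der_bracket:
  assumes v: "compatible \<mu> a" and v': "compatible \<mu>' a'"
  shows "super_comm UNIV (JD R S c \<mu> a) (JD R' S' c' \<mu>' a')
    = JD (br_R R S c \<mu> R' S' c' \<mu>') (br_S R S \<mu> a R' S' \<mu>' a') (br_c R S c \<mu> a R' S' c' \<mu>' a')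
        (br_mu S \<mu> S' \<mu>') (br_a S \<mu> a S' \<mu>' a')"
  unfolding super_comm_def sum_bool J_der_mproj[OF v] J_der_mproj[OF v'] ssign_def
  by (rule ext, rule jb_ext;
      simp add: compatibleD[OF v] compatibleD[OF v'] br_defs der_leibniz algebra_simps)

text \<open>By the Jacobi identity \<open>[[\<mu>, \<mu>'], \<delta>] = 2 (\<mu>(a') - \<mu>'(a))
  \<delta>\<close>, the terms with \<open>a a'\<close> cancelling; the summand with
  \<open>dotS S S'\<close> is an inner pair.\<close>

lemma compatible_br:
  assumes v: "compatible \<mu> a" and v': "compatible \<mu>' a'"
  shows "compatible (br_mu S \<mu> S' \<mu>') (br_a S \<mu> a S' \<mu>' a')"
  unfolding compatible_def
  by (intro conjI allI; simp add: compatibleD[OF v] compatibleD[OF v'] br_defs der_leibniz algebra_simps)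

section \<open>Inner derivations of J\<close>

text \<open>Only the \<open>x\<close> coefficients of \<open>u\<close> and \<open>v\<close> reach
  the derivation of \<open>Z\<close>, and they give an inner pair with
  \<open>g = - u X * v X\<close>. This bounds \<open>Inder\<close> from above.\<close>

lemma Dop_J:
  "Dop (jmul \<delta>) UNIV u v = JD
     (\<lambda>i. u X * v (Xv i) + u (Xv i) * v X + (case i of
          I1 \<Rightarrow> u (W I2) * v (W I3) - u (W I3) * v (W I2)
        | I2 \<Rightarrow> u (W I3) * v (W I1) - u (W I1) * v (W I3)
        | I3 \<Rightarrow> u (W I2) * v (W I1) - u (W I1) * v (W I2)))
     (\<lambda>i. u X * v (W i) - u (W i) * v X)
     (\<delta> (u One) * v X - \<delta> (v One) * u X + dotS (u \<circ> W) (v \<circ> Xv) - dotS (v \<circ> W) (u \<circ> Xv))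
     (\<lambda>h. 2 * (- u X * v X) * \<delta> h) (- \<delta> (- u X * v X))"
  unfolding Dop_def sum_bool ssign_def
  by (rule ext, rule jb_ext; simp add: jmul_coords proj_def dotS_def der_leibniz algebra_simps)

definition J_inner :: "((jb \<Rightarrow> 'z) \<Rightarrow> jb \<Rightarrow> 'z) set" where
  "J_inner = {JD R S c (\<lambda>h. 2 * g * \<delta> h) (- \<delta> g) | R S c g. True}"

lemma J_innerI: "JD R S c (\<lambda>h. 2 * g * \<delta> h) (- \<delta> g) \<in> J_inner"
  unfolding J_inner_def mem_Collect_eq
  by (rule exI[of _ R], rule exI[of _ S], rule exI[of _ c], rule exI[of _ g]) simp

section \<open>Spans of the operators \<open>D(a, b)\<close>\<close>

lemma Inder_0: "0 \<in> Inder emb mul A"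
  unfolding Inder_def by (rule CollectI, rule exI[of _ 0]) (auto simp: zero_fun_def)

lemma Inder_add:
  assumes "D \<in> Inder emb mul A" "E \<in> Inder emb mul A"
  shows "D + E \<in> Inder emb mul A"
proof -
  obtain n :: nat and cs as bs where D: "D = (\<lambda>u. \<Sum>i<n. fscal emb (cs i) (Dop mul A (as i) (bs i) u))"
    "\<forall>i<n. as i \<in> A \<and> bs i \<in> A" using assms(1) unfolding Inder_def by blast
  obtain m :: nat and cs' as' bs' where E: "E = (\<lambda>u. \<Sum>i<m. fscal emb (cs' i) (Dop mul A (as' i) (bs' i) u))"
    "\<forall>i<m. as' i \<in> A \<and> bs' i \<in> A" using assms(2) unfolding Inder_def by blast
  \<comment> \<open>Concatenation of the two families of summands, the second starting at index
    \<open>n\<close>.\<close>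
  let ?j = "\<lambda>f f' i. if i < n then f i else f' (i - n)"
  have *: "(\<Sum>i<n + m. f i) = (\<Sum>i<n. f i) + (\<Sum>i<m. f (n + i))" for f :: "nat \<Rightarrow> jb \<Rightarrow> 'z" and n m
    by (induction m) (simp_all add: add.assoc)
  show ?thesis
    unfolding Inder_def
  proof (rule CollectI, rule exI[of _ "n + m"], intro exI conjI)
    show "D + E = (\<lambda>u. \<Sum>i<n + m. fscal emb (?j cs cs' i) (Dop mul A (?j as as' i) (?j bs bs' i) u))"
      unfolding * D E by (rule ext) simp
    show "\<forall>i<n + m. ?j as as' i \<in> A \<and> ?j bs bs' i \<in> A"
      using D(2) E(2) by auto
  qed
qed

lemma Inder_Dop: "a \<in> A \<Longrightarrow> b \<in> A \<Longrightarrow> Dop mul A a b \<in> Inder emb mul A"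
  unfolding Inder_def
  by (rule CollectI, rule exI[of _ 1], rule exI[of _ "\<lambda>_. 1"], rule exI[of _ "\<lambda>_. a"], rule exI[of _ "\<lambda>_. b"])
    (simp add: fscal_def)

text \<open>Replaces the explicit finite sums by closure conditions; it yields the upper bounds for
  \<open>Inder\<close> of \<open>J\<close> and of \<open>K\<close>.\<close>

lemma Inder_induct:
  assumes "D \<in> Inder emb mul A"
    and "P 0" "\<And>D E. P D \<Longrightarrow> P E \<Longrightarrow> P (D + E)"
    and "\<And>s a b. a \<in> A \<Longrightarrow> b \<in> A \<Longrightarrow> P (\<lambda>u. fscal emb s (Dop mul A a b u))"
  shows "P D"
proof -
  obtain n :: nat and cs as bs where D: "D = (\<lambda>u. \<Sum>i<n. fscal emb (cs i) (Dop mul A (as i) (bs i) u))"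
    "\<forall>i<n. as i \<in> A \<and> bs i \<in> A" using assms(1) unfolding Inder_def by blast
  have "P (\<lambda>u. \<Sum>i<k. fscal emb (cs i) (Dop mul A (as i) (bs i) u))" if "k \<le> n" for k
    using that
  proof (induction k)
    case 0 then show ?case using assms(2) by (simp add: zero_fun_def)
  next
    case (Suc k)
    have "(\<lambda>u. \<Sum>i<Suc k. fscal emb (cs i) (Dop mul A (as i) (bs i) u))
      = (\<lambda>u. \<Sum>i<k. fscal emb (cs i) (Dop mul A (as i) (bs i) u)) + (\<lambda>u. fscal emb (cs k) (Dop mul A (as k) (bs k) u))"
      by (rule ext) simp
    moreover have "P \<dots>" by (rule assms(3)) (use Suc D(2) assms(4) in auto)
    ultimately show ?case by (simp only:)
  qed
  then show ?thesis using D by auto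
qed

lemma J_der_inner_add:
  "JD R S c (\<lambda>h. 2 * g * \<delta> h) (- \<delta> g) + JD R' S' c' (\<lambda>h. 2 * g' * \<delta> h) (- \<delta> g')
    = JD (R + R') (S + S') (c + c') (\<lambda>h. 2 * (g + g') * \<delta> h) (- \<delta> (g + g'))"
  by (rule ext, rule jb_ext; simp add: algebra_simps)

lemma J_inner_0: "0 \<in> J_inner"
proof -
  have "JD 0 0 0 (\<lambda>h. 2 * 0 * \<delta> h) (- \<delta> 0) = 0"
    by (rule ext, rule jb_ext) simp_all
  then show ?thesis using J_innerI[of 0 0 0 0] by (simp only:)
qed

lemma J_inner_add:
  assumes "D \<in> J_inner" "E \<in> J_inner"
  shows "D + E \<in> J_inner"
proof -
  from assms(1) obtain R S c g where "D = JD R S c (\<lambda>h. 2 * g * \<delta> h) (- \<delta> g)"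
    unfolding J_inner_def by auto
  moreover from assms(2) obtain R' S' c' g' where "E = JD R' S' c' (\<lambda>h. 2 * g' * \<delta> h) (- \<delta> g')"
    unfolding J_inner_def by auto
  ultimately have "D + E = JD (R + R') (S + S') (c + c') (\<lambda>h. 2 * (g + g') * \<delta> h) (- \<delta> (g + g'))"
    by (simp only: J_der_inner_add)
  then show ?thesis using J_innerI[of "R + R'" "S + S'" "c + c'" "g + g'"] by (simp only:)
qed

lemma J_inner_scal:
  assumes "D \<in> J_inner"
  shows "(\<lambda>u. fscal emb s (D u)) \<in> J_inner"
proof -
  from assms obtain R S c g where D: "D = JD R S c (\<lambda>h. 2 * g * \<delta> h) (- \<delta> g)"
    unfolding J_inner_def by auto
  have "(\<lambda>h. emb s * (2 * g * \<delta> h)) = (\<lambda>h. 2 * (emb s * g) * \<delta> h)" "emb s * (- \<delta> g) = - \<delta> (emb s * g)"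
    by (auto simp: der_leibniz algebra_simps)
  then show ?thesis
    unfolding D J_der_scal
    using J_innerI[of "\<lambda>i. emb s * R i" "\<lambda>i. emb s * S i" "emb s * c" "emb s * g"] by (simp only:)
qed

lemma J_der_cong:
  "R = R' \<Longrightarrow> S = S' \<Longrightarrow> c = c' \<Longrightarrow> \<mu> = \<mu>' \<Longrightarrow> a = a' \<Longrightarrow> JD R S c \<mu> a = JD R' S' c' \<mu>' a'"
  by simp

text \<open>One pair of arguments for each kind of data. Zero is written as
  \<open>2 * 0 * \<delta> h\<close> so that \<open>J_der_inner_add\<close> can add these operators
  to the one carrying \<open>g\<close>.\<close>

lemma Dop_J_basis:
  "Dop (jmul \<delta>) UNIV (single X 1) (single (Xv j) f)
    = JD (\<lambda>i. if i = j then f else 0) 0 0 (\<lambda>h. 2 * 0 * \<delta> h) (- \<delta> 0)"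
  "Dop (jmul \<delta>) UNIV (single X 1) (single (W j) f)
    = JD 0 (\<lambda>i. if i = j then f else 0) 0 (\<lambda>h. 2 * 0 * \<delta> h) (- \<delta> 0)"
  "Dop (jmul \<delta>) UNIV (single (W I1) 1) (single (Xv I1) c) = JD 0 0 c (\<lambda>h. 2 * 0 * \<delta> h) (- \<delta> 0)"
  "Dop (jmul \<delta>) UNIV (single X (- g)) (single X 1) = JD 0 0 0 (\<lambda>h. 2 * g * \<delta> h) (- \<delta> g)"
  unfolding Dop_J by (rule J_der_cong; auto simp: single_apply dotS_def split: i3.splits)+

lemma Inder_J: "Inder emb (jmul \<delta>) UNIV = J_inner"
proof (intro equalityI subsetI)
  fix D assume D: "D \<in> Inder emb (jmul \<delta>) UNIV"
  show "D \<in> J_inner"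
    by (rule Inder_induct[where P = "\<lambda>D. D \<in> J_inner", OF D J_inner_0 J_inner_add J_inner_scal])
      (simp_all only: Dop_J J_innerI)
next
  fix D assume "D \<in> J_inner"
  then obtain R S c g where D: "D = JD R S c (\<lambda>h. 2 * g * \<delta> h) (- \<delta> g)" unfolding J_inner_def by auto
  let ?D = "Dop (jmul \<delta>) UNIV"
  \<comment> \<open>One summand for each entry of \<open>R\<close> and of \<open>S\<close>, one for
    \<open>c\<close> and one for \<open>g\<close>.\<close>
  have "D = (?D (single X 1) (single (Xv I1) (R I1)) + (?D (single X 1) (single (Xv I2) (R I2)) + ?D (single X 1) (single (Xv I3) (R I3))))
    + ((?D (single X 1) (single (W I1) (S I1)) + (?D (single X 1) (single (W I2) (S I2)) + ?D (single X 1) (single (W I3) (S I3))))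
    + (?D (single (W I1) 1) (single (Xv I1) c) + ?D (single X (- g)) (single X 1)))"
    unfolding D Dop_J_basis J_der_inner_add
    by (intro J_der_cong i3_ext) auto
  then show "D \<in> Inder emb (jmul \<delta>) UNIV"
    by (simp only: Inder_add Inder_Dop UNIV_I)
qed

section \<open>The subalgebra K\<close>

text \<open>An even derivation of \<open>K\<close> plus \<open>eta c\<close>. The value
  \<open>0\<close> off \<open>Kset\<close> follows the convention of \<open>linmap\<close>, so that
  maps agreeing on \<open>K\<close> are equal functions.\<close>

definition K_der :: "('z \<Rightarrow> 'z) \<Rightarrow> 'z \<Rightarrow> 'z \<Rightarrow> (jb \<Rightarrow> 'z) \<Rightarrow> jb \<Rightarrow> 'z" where
  "K_der \<mu> a c u = (if u \<in> Kset then single One (\<mu> (u One) + c * u X) + single X (\<mu> (u X) + a * u X) else 0)"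

lemma Kset_coords: "u \<in> Kset \<Longrightarrow> u (W i) = 0" "u \<in> Kset \<Longrightarrow> u (Xv i) = 0"
  by (auto simp: Kset_def)

lemma Kset_single [simp]: "single One f \<in> Kset" "single X f \<in> Kset" "0 \<in> Kset"
  by (auto simp: Kset_def single_def)

lemma Kset_add [simp]: "u \<in> Kset \<Longrightarrow> v \<in> Kset \<Longrightarrow> u + v \<in> (Kset :: (jb \<Rightarrow> 'z) set)"
  by (auto simp: Kset_def)

lemma Kset_diff [simp]: "u \<in> Kset \<Longrightarrow> v \<in> Kset \<Longrightarrow> u - v \<in> (Kset :: (jb \<Rightarrow> 'z) set)"
  "u \<in> Kset \<Longrightarrow> - u \<in> (Kset :: (jb \<Rightarrow> 'z) set)"
  by (auto simp: Kset_def)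

lemma Kset_proj [simp]: "u \<in> Kset \<Longrightarrow> proj p u \<in> Kset"
  by (auto simp: Kset_def proj_def)

lemma Kset_fscal [simp]: "u \<in> Kset \<Longrightarrow> fscal emb s u \<in> Kset"
  by (auto simp: Kset_def fscal_def)

lemma Kset_jmul [simp]:
  assumes "u \<in> Kset" "v \<in> Kset" shows "jmul \<delta> u v \<in> Kset"
proof -
  have "jmul \<delta> u v (W i) = 0" "jmul \<delta> u v (Xv i) = 0" for i
    using assms by (cases i; simp add: jmul_coords Kset_coords)+
  then show ?thesis unfolding Kset_def by (auto, metis jb.exhaust)
qed

lemma K_der_Kset [simp]: "K_der \<mu> a c u \<in> Kset"
  by (simp add: K_der_def)

lemma K_der_coords:
  "u \<in> Kset \<Longrightarrow> K_der \<mu> a c u One = \<mu> (u One) + c * u X"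
  "u \<in> Kset \<Longrightarrow> K_der \<mu> a c u X = \<mu> (u X) + a * u X"
  "K_der \<mu> a c u (W i) = 0" "K_der \<mu> a c u (Xv i) = 0"
  by (auto simp: K_der_def single_apply)

lemma K_der_outside: "u \<notin> Kset \<Longrightarrow> K_der \<mu> a c u = 0"
  by (simp add: K_der_def)

lemma Kset_ext:
  assumes "u \<in> Kset" "v \<in> Kset" "u One = v One" "u X = v X"
  shows "u = v"
  using assms by (intro jb_ext) (simp_all add: Kset_coords)

lemma Kmap_ext:
  assumes "\<And>u. u \<in> Kset \<Longrightarrow> D u \<in> Kset" "\<And>u. u \<in> Kset \<Longrightarrow> E u \<in> Kset"
    "\<And>u. u \<in> Kset \<Longrightarrow> D u One = E u One" "\<And>u. u \<in> Kset \<Longrightarrow> D u X = E u X"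
    "\<And>u. u \<notin> Kset \<Longrightarrow> D u = E u"
  shows "D = E"
  by (rule ext) (metis assms Kset_ext)

lemma K_der_even_sder:
  assumes v: "compatible \<mu> a"
  shows "is_sder emb (jmul \<delta>) Kset False (K_der \<mu> a 0)"
  unfolding is_sder_def linmap_def homog_def
proof (intro conjI allI ballI impI)
  note vs = compatibleD[OF assms]
  fix u v :: "jb \<Rightarrow> 'z" assume K: "u \<in> Kset" "v \<in> Kset"
  show "K_der \<mu> a 0 (u + v) = K_der \<mu> a 0 u + K_der \<mu> a 0 v"
    by (rule Kset_ext) (simp_all add: K K_der_coords vs algebra_simps)
  show "K_der \<mu> a 0 (jmul \<delta> u v) = jmul \<delta> (K_der \<mu> a 0 u) v + ssign False q (jmul \<delta> u (K_der \<mu> a 0 v))" for q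
    by (rule Kset_ext) (simp_all add: K K_der_coords Kset_coords vs ssign_def jmul_coords der_leibniz algebra_simps)
next
  fix u :: "jb \<Rightarrow> 'z" and s assume K: "u \<in> Kset"
  show "K_der \<mu> a 0 (fscal emb s u) = fscal emb s (K_der \<mu> a 0 u)"
    by (rule Kset_ext) (simp_all add: K K_der_coords fscal_apply compatibleD[OF v] algebra_simps)
next
  fix q and u :: "jb \<Rightarrow> 'z" assume K: "u \<in> Kset" and "proj q u = u"
  note * = homog_coords[OF this(2)]
  show "proj (q \<noteq> False) (K_der \<mu> a 0 u) = K_der \<mu> a 0 u"
    by (rule Kset_ext) (simp_all add: K K_der_coords proj_apply * compatibleD[OF v])
qed (simp_all add: K_der_outside)

text \<open>Parity keeps \<open>Z\<close> in \<open>Z\<close> and sends \<open>x\<close> to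
  \<open>a x\<close>, so \<open>\<mu>\<close> and \<open>a\<close> determine \<open>D\<close>; the
  product \<open>(h x) x = \<delta>(h)\<close> gives the last clause of compatibility.\<close>

lemma even_sder_K_der:
  assumes D: "is_sder emb (jmul \<delta>) Kset False D"
  obtains \<mu> a where "compatible \<mu> a" "D = K_der \<mu> a 0"
proof -
  define \<mu> where "\<mu> = (\<lambda>h. D (single One h) One)"
  define a where "a = D (single X 1) X"
  have add: "D (u + v) = D u + D v" and mult: "D (jmul \<delta> u v) = jmul \<delta> (D u) v + jmul \<delta> u (D v)"
    if "u \<in> Kset" "v \<in> Kset" "homog q u" for q u v
    using D that by (auto simp: is_sder_def linmap_def ssign_def)
  have K: "D u \<in> Kset" and par: "homog q u \<Longrightarrow> proj q (D u) = D u" and out: "v \<notin> Kset \<Longrightarrow> D v = 0"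
    and sc: "D (fscal emb s u) = fscal emb s (D u)" if "u \<in> Kset" for u v q s
    using D that by (auto simp: is_sder_def linmap_def homog_def)
  have O: "D (single One h) = single One (\<mu> h)" for h
    using homog_coords(1)[OF par[of "single One h" False]]
    by (intro Kset_ext) (simp_all add: K \<mu>_def single_apply)
  have X1: "D (single X 1) = single X a"
    using homog_coords(3)[OF par[of "single X 1" True]]
    by (intro Kset_ext) (simp_all add: K a_def single_apply)
  have Xh: "D (single X h) = single X (\<mu> h + a * h)" for h
  proof -
    have "D (single X h) = jmul \<delta> (single One (\<mu> h)) (single X 1) + jmul \<delta> (single One h) (single X a)"
      using mult[of "single One h" "single X 1" False] by (simp add: jmul_single O X1)
    also have "\<dots> = single X (\<mu> h + a * h)"
      by (rule ext) (simp add: jmul_single single_apply)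
    finally show ?thesis .
  qed
  have xx: "jmul \<delta> (single X f) (single X g) = single One (\<delta> f * g - f * \<delta> g)" for f g
    by (rule jb_ext; simp add: jmul_coords single_apply)
  have sadd: "single b (g + h) = single b g + single b h" for b and g h :: 'z
    by (auto simp: single_def)
  have ml: "\<mu> (g * h) = g * \<mu> h + \<mu> g * h" for g h
    using fun_cong[OF mult[of "single One g" "single One h" False], of One]
    by (simp add: jmul_single O) (simp add: single_apply)
  have m1: "\<mu> 1 = 0" using ml[of 1 1] by simp
  have md: "\<mu> (\<delta> h) = \<delta> (\<mu> h) + 2 * a * \<delta> h" for h
    using fun_cong[OF mult[of "single X h" "single X 1" True], of One]
    by (simp add: xx O Xh m1) (simp add: single_apply der_leibniz m1 algebra_simps)
  have v: "compatible \<mu> a"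
    unfolding compatible_def
  proof (intro conjI allI)
    fix g h c
    show "\<mu> (g + h) = \<mu> g + \<mu> h"
      using add[of "single One g" "single One h" False] by (simp add: \<mu>_def sadd)
    have "single One (emb c * h) = fscal emb c (single One h)"
      by (auto simp: single_def fscal_def)
    then show "\<mu> (emb c * h) = emb c * \<mu> h"
      using sc[of "single One h" c] by (simp add: \<mu>_def) (simp add: fscal_def)
  qed (rule ml, rule md)
  have "D = K_der \<mu> a 0"
  proof
    fix u
    show "D u = K_der \<mu> a 0 u"
    proof (cases "u \<in> Kset")
      case True
      then have "u = single One (u One) + single X (u X)"
        by (intro Kset_ext) (simp_all add: single_apply)
      then have "D u = D (single One (u One)) + D (single X (u X))"
        using add[of "single One (u One)" "single X (u X)" False] by simp
      also have "\<dots> = K_der \<mu> a 0 u"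
        using True by (simp add: K_der_def O Xh)
      finally show ?thesis .
    next
      case False
      then show ?thesis using out[of 0 u] by (simp add: K_der_outside)
    qed
  qed
  with v show ?thesis by (rule that)
qed

lemma K_der_add: "K_der \<mu> a c + K_der \<mu>' a' c' = K_der (\<mu> + \<mu>') (a + a') (c + c')"
  by (rule Kmap_ext) (simp_all add: K_der_coords K_der_outside algebra_simps)

lemma K_der_scal: "(\<lambda>u. fscal emb s (K_der \<mu> a c u)) = K_der (\<lambda>h. emb s * \<mu> h) (emb s * a) (emb s * c)"
proof (rule Kmap_ext)
  fix u :: "jb \<Rightarrow> 'z"
  show "u \<notin> Kset \<Longrightarrow> fscal emb s (K_der \<mu> a c u) = K_der (\<lambda>h. emb s * \<mu> h) (emb s * a) (emb s * c) u"
    by (auto simp add: K_der_outside fscal_apply)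
qed (simp_all add: K_der_coords fscal_apply algebra_simps)

lemma eta_eq: "eta c = K_der (\<lambda>_. 0) 0 c"
  by (rule Kmap_ext) (auto simp: eta_def K_der_coords K_der_outside single_apply)

lemma DerBarK_eq: "DerBarK emb \<delta> = {K_der \<mu> a c | \<mu> a c. compatible \<mu> a}"
proof (intro equalityI subsetI)
  fix D assume "D \<in> DerBarK emb \<delta>"
  then obtain D0 c where D: "D = D0 + eta c" and D0: "is_sder emb (jmul \<delta>) Kset False D0"
    by (auto simp: DerBarK_def)
  from D0 obtain \<mu> a where v: "compatible \<mu> a" and "D0 = K_der \<mu> a 0" by (rule even_sder_K_der)
  then have "D = K_der \<mu> a c"
    unfolding D eta_eq by (simp add: K_der_add) (simp add: plus_fun_def)
  with v show "D \<in> {K_der \<mu> a c | \<mu> a c. compatible \<mu> a}" by auto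
next
  fix D assume "D \<in> {K_der \<mu> a c | \<mu> a c. compatible \<mu> a}"
  then obtain \<mu> a c where D: "D = K_der \<mu> a c" and v: "compatible \<mu> a" by auto
  have "D = K_der \<mu> a 0 + eta c"
    unfolding D eta_eq K_der_add by (simp add: plus_fun_def)
  with K_der_even_sder[OF v] show "D \<in> DerBarK emb \<delta>"
    unfolding DerBarK_def by auto
qed

lemma K_der_inject:
  assumes "compatible \<mu> a" "compatible \<mu>' a'" "K_der \<mu> a c = K_der \<mu>' a' c'"
  shows "\<mu> = \<mu>' \<and> a = a' \<and> c = c'"
proof -
  have e: "K_der \<mu> a c u k = K_der \<mu>' a' c' u k" for u k using assms(3) by simp
  have "\<mu> = \<mu>'" using e[of "single One _" One] by (simp add: K_der_coords single_apply fun_eq_iff)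
  moreover have "c = c'" "a = a'"
    using e[of "single X 1" One] e[of "single X 1" X] compatibleD[OF assms(1)] compatibleD[OF assms(2)]
    by (simp_all add: K_der_coords single_apply)
  ultimately show ?thesis by simp
qed

lemma K_der_mproj:
  assumes "compatible \<mu> a"
  shows "mproj Kset p (K_der \<mu> a c) = (if p then K_der (\<lambda>_. 0) 0 c else K_der \<mu> a 0)"
proof (rule Kmap_ext)
  show "mproj Kset p (K_der \<mu> a c) u X = (if p then K_der (\<lambda>_. 0) 0 c else K_der \<mu> a 0) u X"
     "mproj Kset p (K_der \<mu> a c) u One = (if p then K_der (\<lambda>_. 0) 0 c else K_der \<mu> a 0) u One" if "u \<in> Kset" for u
    using that by (cases p; simp add: mproj_def K_der_coords proj_apply compatibleD[OF assms])+
qed (auto simp: mproj_def K_der_outside)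

lemma K_der_bracket:
  assumes v: "compatible \<mu> a" and v': "compatible \<mu>' a'"
  shows "super_comm Kset (K_der \<mu> a c) (K_der \<mu>' a' c')
    = K_der (\<lambda>h. \<mu> (\<mu>' h) - \<mu>' (\<mu> h)) (\<mu> a' - \<mu>' a) (\<mu> c' - a * c' - \<mu>' c + a' * c)"
proof -
  \<comment> \<open>Covers arguments outside \<open>Kset\<close>, where the inner map of a
    composition returns \<open>0\<close>.\<close>
  have K0: "K_der \<mu> a c 0 = 0" if "compatible \<mu> a" for \<mu> a c
    by (rule Kset_ext) (simp_all add: K_der_coords compatibleD[OF that])
  show ?thesis
    unfolding super_comm_def sum_bool K_der_mproj[OF v] K_der_mproj[OF v'] ssign_def
    by (rule Kmap_ext)
       (simp_all add: K_der_coords K_der_outside K0 v v' compatible_zero compatibleD[OF v] compatibleD[OF v'] algebra_simps)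
qed

lemma Dop_K:
  assumes "u \<in> Kset" "v \<in> Kset"
  shows "Dop (jmul \<delta>) Kset u v
    = K_der (\<lambda>h. 2 * (- u X * v X) * \<delta> h) (- \<delta> (- u X * v X)) (\<delta> (u One) * v X - \<delta> (v One) * u X)"
proof -
  show ?thesis
    unfolding Dop_def sum_bool ssign_def
    by (rule Kmap_ext)
       (simp_all add: assms K_der_coords K_der_outside jmul_coords proj_apply Kset_coords der_leibniz algebra_simps)
qed

definition K_inner :: "((jb \<Rightarrow> 'z) \<Rightarrow> jb \<Rightarrow> 'z) set" where
  "K_inner = {K_der (\<lambda>h. 2 * g * \<delta> h) (- \<delta> g) c | g c. True}"

lemma K_innerI: "K_der (\<lambda>h. 2 * g * \<delta> h) (- \<delta> g) c \<in> K_inner"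
  unfolding K_inner_def mem_Collect_eq by (rule exI[of _ g], rule exI[of _ c]) simp

lemma K_der_cong: "\<mu> = \<mu>' \<Longrightarrow> a = a' \<Longrightarrow> c = c' \<Longrightarrow> K_der \<mu> a c = K_der \<mu>' a' c'"
  by simp

lemma K_inner_0: "0 \<in> K_inner"
proof -
  have "K_der (\<lambda>h. 2 * 0 * \<delta> h) (- \<delta> 0) 0 = 0"
    by (rule Kmap_ext) (auto simp: K_der_coords K_der_outside)
  then show ?thesis using K_innerI[of 0 0] by (simp only:)
qed

lemma K_der_inner_add:
  "K_der (\<lambda>h. 2 * g * \<delta> h) (- \<delta> g) c + K_der (\<lambda>h. 2 * g' * \<delta> h) (- \<delta> g') c'
    = K_der (\<lambda>h. 2 * (g + g') * \<delta> h) (- \<delta> (g + g')) (c + c')"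
  unfolding K_der_add by (rule K_der_cong) (auto simp: algebra_simps)

lemma K_inner_add:
  assumes "D \<in> K_inner" "E \<in> K_inner"
  shows "D + E \<in> K_inner"
proof -
  from assms(1) obtain c g where "D = K_der (\<lambda>h. 2 * g * \<delta> h) (- \<delta> g) c"
    unfolding K_inner_def by auto
  moreover from assms(2) obtain c' g' where "E = K_der (\<lambda>h. 2 * g' * \<delta> h) (- \<delta> g') c'"
    unfolding K_inner_def by auto
  ultimately have "D + E = K_der (\<lambda>h. 2 * (g + g') * \<delta> h) (- \<delta> (g + g')) (c + c')"
    by (simp only: K_der_inner_add)
  then show ?thesis using K_innerI[of "g + g'" "c + c'"] by (simp only:)
qed

lemma K_inner_scal:
  assumes "D \<in> K_inner"
  shows "(\<lambda>u. fscal emb s (D u)) \<in> K_inner"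
proof -
  from assms obtain c g where D: "D = K_der (\<lambda>h. 2 * g * \<delta> h) (- \<delta> g) c"
    unfolding K_inner_def by auto
  have "(\<lambda>h. emb s * (2 * g * \<delta> h)) = (\<lambda>h. 2 * (emb s * g) * \<delta> h)" "emb s * (- \<delta> g) = - \<delta> (emb s * g)"
    by (auto simp: der_leibniz algebra_simps)
  then show ?thesis
    unfolding D K_der_scal using K_innerI[of "emb s * g" "emb s * c"] by (simp only:)
qed

text \<open>The pair \<open>(\<mu>, a)\<close> is restricted as in \<open>J\<close>, but every
  \<open>eta c\<close> is inner, again by \<open>Z \<delta>(Z) = Z\<close>.\<close>

lemma Inder_K: "Inder emb (jmul \<delta>) Kset = K_inner"
proof (intro equalityI subsetI)
  fix D assume D: "D \<in> Inder emb (jmul \<delta>) Kset"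
  have *: "(\<lambda>u. fscal emb s (Dop (jmul \<delta>) Kset a b u)) \<in> K_inner" if "a \<in> Kset" "b \<in> Kset" for s a b
    by (rule K_inner_scal) (simp only: Dop_K[OF that] K_innerI)
  show "D \<in> K_inner"
    by (rule Inder_induct[where P = "\<lambda>D. D \<in> K_inner", OF D K_inner_0 K_inner_add *])
next
  fix D assume "D \<in> K_inner"
  then obtain c g where D: "D = K_der (\<lambda>h. 2 * g * \<delta> h) (- \<delta> g) c" unfolding K_inner_def by auto
  have 1: "K_der (\<lambda>_. 0) 0 (\<Sum>j<n. f j * \<delta> (k j)) \<in> Inder emb (jmul \<delta>) Kset" for f k and n :: nat
  proof (induction n)
    case 0
    have "K_der (\<lambda>_. 0) 0 0 = 0"
      by (rule Kmap_ext) (auto simp: K_der_coords K_der_outside)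
    then show ?case by (simp only: lessThan_0 sum.empty Inder_0)
  next
    case (Suc n)
    \<comment> \<open>\<open>D(k, f x)\<close> is \<open>eta (f \<delta>(k))\<close>, and sums of
      these reach every \<open>eta c\<close>.\<close>
    have "Dop (jmul \<delta>) Kset (single One (k n)) (single X (f n)) = K_der (\<lambda>_. 0) 0 (f n * \<delta> (k n))"
      unfolding Dop_K[OF Kset_single(1) Kset_single(2)] by (rule K_der_cong) (auto simp: single_apply)
    then have "K_der (\<lambda>_. 0) 0 (f n * \<delta> (k n)) \<in> Inder emb (jmul \<delta>) Kset"
      using Inder_Dop[OF Kset_single(1)[of "k n"] Kset_single(2)[of "f n"], of "jmul \<delta>"] by (simp only:)
    from Inder_add[OF Suc this] have "K_der ((\<lambda>_. 0) + (\<lambda>_. 0)) (0 + 0) ((\<Sum>j<n. f j * \<delta> (k j)) + f n * \<delta> (k n)) \<in> Inder emb (jmul \<delta>) Kset"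
      by (simp only: K_der_add)
    then show ?case by (simp add: plus_fun_def)
  qed
  have 2: "K_der (\<lambda>_. 0) 0 c \<in> Inder emb (jmul \<delta>) Kset"
    using span[of c] 1 by metis
  have "Dop (jmul \<delta>) Kset (single X (- g)) (single X 1) = K_der (\<lambda>h. 2 * g * \<delta> h) (- \<delta> g) 0"
    unfolding Dop_K[OF Kset_single(2) Kset_single(2)] by (rule K_der_cong) (auto simp: single_apply)
  then have "K_der (\<lambda>h. 2 * g * \<delta> h) (- \<delta> g) 0 \<in> Inder emb (jmul \<delta>) Kset"
    using Inder_Dop[OF Kset_single(2)[of "- g"] Kset_single(2)[of 1], of "jmul \<delta>"] by (simp only:)
  from Inder_add[OF this 2] show "D \<in> Inder emb (jmul \<delta>) Kset"
    unfolding D K_der_add by (simp add: plus_fun_def)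
qed

section \<open>The Tits construction\<close>

abbreviation "\<epsilon> \<equiv> emb \<iota>"

lemma eps_sq: "\<epsilon> * \<epsilon> = -1" "\<epsilon> * (\<epsilon> * z) = - z"
proof -
  show *: "\<epsilon> * \<epsilon> = -1" by (simp add: sqrt_m1 flip: emb_mult)
  show "\<epsilon> * (\<epsilon> * z) = - z" by (simp add: * flip: mult.assoc)
qed

text \<open>With these scalings the rotations \<open>R\<close> acquire the structure constants of the basis \<open>Eb\<close>, and
  the odd generators satisfy \<open>[S\<^sub>i, S\<^sub>i] = - D(x, x)\<close>, as \<open>trace(E\<^sub>i\<^sup>2) = -2\<close> demands.\<close>

fun even_scale :: "i3 \<Rightarrow> 'z" where "even_scale I1 = - \<epsilon>" | "even_scale I2 = - \<epsilon>" | "even_scale I3 = - 1"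
fun odd_scale :: "i3 \<Rightarrow> 'z" where "odd_scale I1 = - 1" | "odd_scale I2 = - 1" | "odd_scale I3 = \<epsilon>"

definition so3_elem :: "(i3 \<Rightarrow> 'z) \<Rightarrow> (i3 \<Rightarrow> 'z) \<Rightarrow> i3 \<Rightarrow> jb \<Rightarrow> 'z" where
  "so3_elem R S = (\<lambda>k. single One (even_scale k * R k) + single X (odd_scale k * S k))"

lemma so3_elem_Kset [simp]: "so3_elem R S k \<in> Kset"
  by (simp add: so3_elem_def)

lemma so3_elem_coords: "so3_elem R S k One = even_scale k * R k" "so3_elem R S k X = odd_scale k * S k"
    "so3_elem R S k (W i) = 0" "so3_elem R S k (Xv i) = 0"
  by (simp_all add: so3_elem_def single_apply)

text \<open>This basis is negatively oriented: \<open>[E_1, E_2] = - E_3\<close> and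
  cyclically.\<close>

lemma so3_bracket:
  "so3coord (mmul (Eb i) (Eb j) - mmul (Eb j) (Eb i)) k = (if (i, j, k) \<in> {(I1, I2, I3), (I2, I3, I1), (I3, I1, I2)} then -1
     else if (i, j, k) \<in> {(I2, I1, I3), (I3, I2, I1), (I1, I3, I2)} then 1 else (0::'f))"
  by (cases i; cases j; cases k; simp add: mmul_def sum_i3 emat_def)

lemma so3_trace: "(1/2) * mtrace (mmul (Eb i) (Eb j)) = (if i = j then -1 else (0::'f))"
  using char by (cases i; cases j; simp add: mtrace_def mmul_def sum_i3 emat_def field_simps)

lemma so3_bracket_sum:
  fixes t :: "i3 \<Rightarrow> i3 \<Rightarrow> jb \<Rightarrow> 'z"
  shows "(\<Sum>i\<in>UNIV. \<Sum>j\<in>UNIV. fscal emb (so3coord (mmul (Eb i) (Eb j) - mmul (Eb j) (Eb i)) k) (t i j))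
    = (case k of I1 \<Rightarrow> t I3 I2 - t I2 I3 | I2 \<Rightarrow> t I1 I3 - t I3 I1 | I3 \<Rightarrow> t I2 I1 - t I1 I2)"
  unfolding so3_bracket sum_i3 by (cases k; rule ext; simp add: fscal_apply)

lemma so3_trace_sum:
  fixes t :: "i3 \<Rightarrow> i3 \<Rightarrow> (jb \<Rightarrow> 'z) \<Rightarrow> jb \<Rightarrow> 'z"
  shows "(\<Sum>i\<in>UNIV. \<Sum>j\<in>UNIV. (\<lambda>u. fscal emb ((1/2) * mtrace (mmul (Eb i) (Eb j))) (t i j u)))
    = - t I1 I1 - t I2 I2 - t I3 I3"
  unfolding so3_trace sum_i3 by (rule ext, rule ext) (simp add: fscal_apply)

text \<open>Since \<open>even_scale k = \<epsilon> * odd_scale k\<close>, the factor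
  \<open>\<epsilon>\<close> on \<open>c\<close> and \<open>c'\<close> is what matches the terms
  \<open>c * S' k\<close> and \<open>c' * S k\<close> of \<open>br_R\<close>.\<close>

lemma Tits_bracket_so3:
  assumes v: "compatible \<mu> a" and v': "compatible \<mu>' a'"
  shows "(\<lambda>k. \<Sum>i\<in>UNIV. \<Sum>j\<in>UNIV. fscal emb (so3coord (mmul (Eb i) (Eb j) - mmul (Eb j) (Eb i)) k)
              (jmul \<delta> (so3_elem R S i) (so3_elem R' S' j)))
         + (\<lambda>k. K_der \<mu> a (\<epsilon> * c) (so3_elem R' S' k))
         - (\<lambda>k. \<Sum>p\<in>UNIV. \<Sum>q\<in>UNIV. ssign p q (mproj Kset q (K_der \<mu>' a' (\<epsilon> * c')) (proj p (so3_elem R S k))))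
       = so3_elem (br_R R S c \<mu> R' S' c' \<mu>') (br_S R S \<mu> a R' S' \<mu>' a')"
proof (rule ext)
  fix k
  show "((\<lambda>k. \<Sum>i\<in>UNIV. \<Sum>j\<in>UNIV. fscal emb (so3coord (mmul (Eb i) (Eb j) - mmul (Eb j) (Eb i)) k)
              (jmul \<delta> (so3_elem R S i) (so3_elem R' S' j)))
         + (\<lambda>k. K_der \<mu> a (\<epsilon> * c) (so3_elem R' S' k))
         - (\<lambda>k. \<Sum>p\<in>UNIV. \<Sum>q\<in>UNIV. ssign p q (mproj Kset q (K_der \<mu>' a' (\<epsilon> * c')) (proj p (so3_elem R S k))))) k
       = so3_elem (br_R R S c \<mu> R' S' c' \<mu>') (br_S R S \<mu> a R' S' \<mu>' a') k"
    unfolding so3_bracket_sum sum_bool K_der_mproj[OF v'] ssign_def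
    by (cases k; rule Kset_ext;
        simp add: jmul_coords K_der_coords so3_elem_coords proj_apply br_R_def br_S_def compatibleD[OF v] compatibleD[OF v'] der_leibniz eps_sq algebra_simps)
qed

text \<open>The squares of \<open>odd_scale\<close> are \<open>1\<close>, \<open>1\<close>,
  \<open>- 1\<close>, so the Euclidean trace form turns into \<open>dotS S S'\<close>.\<close>

lemma Tits_bracket_der:
  assumes v: "compatible \<mu> a" and v': "compatible \<mu>' a'"
  shows "(\<Sum>i\<in>UNIV. \<Sum>j\<in>UNIV. (\<lambda>u. fscal emb ((1/2) * mtrace (mmul (Eb i) (Eb j)))
              (Dop (jmul \<delta>) Kset (so3_elem R S i) (so3_elem R' S' j) u)))
         + super_comm Kset (K_der \<mu> a (\<epsilon> * c)) (K_der \<mu>' a' (\<epsilon> * c'))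
       = K_der (br_mu S \<mu> S' \<mu>') (br_a S \<mu> a S' \<mu>' a') (\<epsilon> * br_c R S c \<mu> a R' S' c' \<mu>' a')"
  unfolding so3_trace_sum K_der_bracket[OF v v'] Dop_K[OF so3_elem_Kset so3_elem_Kset]
  by (rule Kmap_ext)
    (simp_all add: K_der_coords K_der_outside so3_elem_coords br_mu_def br_a_def br_c_def dotS_def compatibleD[OF v] compatibleD[OF v']
      der_leibniz eps_sq algebra_simps)

section \<open>The isomorphisms\<close>

definition J_of :: "'z par \<Rightarrow> (jb \<Rightarrow> 'z) \<Rightarrow> jb \<Rightarrow> 'z" where
  "J_of = (\<lambda>(R, S, c, \<mu>, a). JD R S c \<mu> a)"

definition T_of :: "'z par \<Rightarrow> (i3 \<Rightarrow> jb \<Rightarrow> 'z) \<times> ((jb \<Rightarrow> 'z) \<Rightarrow> jb \<Rightarrow> 'z)" where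
  "T_of = (\<lambda>(R, S, c, \<mu>, a). (so3_elem R S, K_der \<mu> a (\<epsilon> * c)))"

definition padd :: "'z par \<Rightarrow> 'z par \<Rightarrow> 'z par" where
  "padd = (\<lambda>(R, S, c, \<mu>, a) (R', S', c', \<mu>', a'). (R + R', S + S', c + c', \<mu> + \<mu>', a + a'))"

definition psmul :: "'f \<Rightarrow> 'z par \<Rightarrow> 'z par" where
  "psmul s = (\<lambda>(R, S, c, \<mu>, a).
     (\<lambda>i. emb s * R i, \<lambda>i. emb s * S i, emb s * c, \<lambda>h. emb s * \<mu> h, emb s * a))"

definition ppar :: "bool \<Rightarrow> 'z par \<Rightarrow> 'z par" where
  "ppar p = (\<lambda>(R, S, c, \<mu>, a). if p then (0, S, c, \<lambda>_. 0, 0) else (R, 0, 0, \<mu>, a))"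

definition pbr :: "'z par \<Rightarrow> 'z par \<Rightarrow> 'z par" where
  "pbr = (\<lambda>(R, S, c, \<mu>, a) (R', S', c', \<mu>', a').
     (br_R R S c \<mu> R' S' c' \<mu>', br_S R S \<mu> a R' S' \<mu>' a', br_c R S c \<mu> a R' S' c' \<mu>' a',
      br_mu S \<mu> S' \<mu>', br_a S \<mu> a S' \<mu>' a'))"

definition params :: "'z par set" where
  "params = {(R, S, c, \<mu>, a) | R S c \<mu> a. compatible \<mu> a}"

definition inner_params :: "'z par set" where
  "inner_params = {(R, S, c, \<mu>, a) | R S c \<mu> a. \<exists>g. \<mu> = (\<lambda>h. 2 * g * \<delta> h) \<and> a = - \<delta> g}"

lemma inner_params_subset: "inner_params \<subseteq> params"
  using compatible_inner by (auto simp: inner_params_def params_def)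

text \<open>Explicit inverses of the scalings, from which \<open>so3_elem\<close> is seen to be
  bijective onto the triples in \<open>K\<close>.\<close>

lemma scale_units:
  "even_scale k * (if k = I3 then -1 else \<epsilon>) = 1" "odd_scale k * (if k = I3 then - \<epsilon> else -1) = 1"
  by (cases k; simp add: eps_sq)+

lemma so3_elem_inject: "so3_elem R S = so3_elem R' S' \<longleftrightarrow> R = R' \<and> S = S'"
proof
  assume eq: "so3_elem R S = so3_elem R' S'"
  have e: "even_scale k * R k = even_scale k * R' k" "odd_scale k * S k = odd_scale k * S' k" for k
    using so3_elem_coords(1,2)[of R S k] so3_elem_coords(1,2)[of R' S' k] eq by simp_all
  have "R k = R' k" "S k = S' k" for k
    using scale_units[of k] e[of k] by (metis mult.assoc mult.commute mult.right_neutral)+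
  then show "R = R' \<and> S = S'" by auto
qed auto

lemma so3_elem_surj:
  assumes "\<And>k. m k \<in> Kset"
  obtains R S where "m = so3_elem R S"
proof
  show "m = so3_elem (\<lambda>k. (if k = I3 then -1 else \<epsilon>) * m k One) (\<lambda>k. (if k = I3 then - \<epsilon> else -1) * m k X)"
    by (rule ext, rule Kset_ext[OF assms so3_elem_Kset])
       (simp_all only: so3_elem_coords mult.assoc[symmetric] scale_units mult_1)
qed

lemma J_of_bij: "bij_betw J_of params (Der emb (jmul \<delta>) UNIV)"
proof (rule bij_betw_imageI)
  show "inj_on J_of params"
  proof (rule inj_onI)
    fix p q assume pq: "p \<in> params" "q \<in> params" "J_of p = J_of q"
    obtain R S c \<mu> a where p: "p = (R, S, c, \<mu>, a)" and v: "compatible \<mu> a" using pq by (auto simp: params_def)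
    obtain R' S' c' \<mu>' a' where q: "q = (R', S', c', \<mu>', a')" and v': "compatible \<mu>' a'"
      using pq by (auto simp: params_def)
    show "p = q"
      using J_der_inject[OF v v'] pq(3) by (simp add: p q J_of_def)
  qed
  show "J_of ` params = Der emb (jmul \<delta>) UNIV"
  proof (intro equalityI subsetI)
    fix D assume "D \<in> J_of ` params"
    then obtain R S c \<mu> a where "D = JD R S c \<mu> a" "compatible \<mu> a" by (auto simp: params_def J_of_def)
    then show "D \<in> Der emb (jmul \<delta>) UNIV"
      unfolding Der_J mem_Collect_eq by (intro exI conjI)
  next
    fix D assume "D \<in> Der emb (jmul \<delta>) UNIV"
    then obtain R S c \<mu> a where "D = J_of (R, S, c, \<mu>, a)" "compatible \<mu> a"
      unfolding Der_J J_of_def by auto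
    then show "D \<in> J_of ` params" unfolding params_def by blast
  qed
qed

lemma J_of_bij_inner: "bij_betw J_of inner_params (Inder emb (jmul \<delta>) UNIV)"
proof (rule bij_betw_imageI)
  show "inj_on J_of inner_params"
    using J_of_bij inner_params_subset by (meson bij_betw_def inj_on_subset)
  show "J_of ` inner_params = Inder emb (jmul \<delta>) UNIV"
  proof (intro equalityI subsetI)
    fix D assume "D \<in> J_of ` inner_params"
    then show "D \<in> Inder emb (jmul \<delta>) UNIV"
      unfolding Inder_J by (auto simp: inner_params_def J_of_def J_innerI)
  next
    fix D assume "D \<in> Inder emb (jmul \<delta>) UNIV"
    then obtain R S c g where "D = J_of (R, S, c, \<lambda>h. 2 * g * \<delta> h, - \<delta> g)"
      unfolding Inder_J J_inner_def J_of_def by auto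
    then show "D \<in> J_of ` inner_params" unfolding inner_params_def by blast
  qed
qed

lemma T_of_inj: "inj_on T_of params"
proof (rule inj_onI)
  fix p q assume pq: "p \<in> params" "q \<in> params" "T_of p = T_of q"
  obtain R S c \<mu> a where p: "p = (R, S, c, \<mu>, a)" and v: "compatible \<mu> a" using pq by (auto simp: params_def)
  obtain R' S' c' \<mu>' a' where q: "q = (R', S', c', \<mu>', a')" and v': "compatible \<mu>' a'" using pq by (auto simp: params_def)
  have "R = R'" "S = S'" "K_der \<mu> a (\<epsilon> * c) = K_der \<mu>' a' (\<epsilon> * c')"
    using pq(3) by (auto simp: p q T_of_def so3_elem_inject)
  moreover have "c = c'" if "\<epsilon> * c = \<epsilon> * c'"
    using arg_cong[OF that, of "\<lambda>z. \<epsilon> * z"] by (simp add: eps_sq)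
  ultimately show "p = q"
    using K_der_inject[OF v v'] by (simp add: p q)
qed

lemma T_of_bij: "bij_betw T_of params (lcar (Tits emb \<delta> (DerBarK emb \<delta>)))"
proof (rule bij_betw_imageI[OF T_of_inj])
  show "T_of ` params = lcar (Tits emb \<delta> (DerBarK emb \<delta>))"
  proof (intro equalityI subsetI)
    fix t assume "t \<in> lcar (Tits emb \<delta> (DerBarK emb \<delta>))"
    then obtain m \<mu> a c where t: "t = (m, K_der \<mu> a c)" and m: "\<And>i. m i \<in> Kset" and v: "compatible \<mu> a"
      by (auto simp: Tits_def DerBarK_eq)
    obtain R S where "m = so3_elem R S" using so3_elem_surj[OF m] .
    \<comment> \<open>\<open>- \<epsilon>\<close> is the inverse of \<open>\<epsilon>\<close>, which
      undoes the factor that \<open>T_of\<close> puts on the fourth datum's companion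
      \<open>c\<close>.\<close>
    then have "t = T_of (R, S, - \<epsilon> * c, \<mu>, a)"
      by (simp add: t T_of_def eps_sq)
    moreover have "(R, S, - \<epsilon> * c, \<mu>, a) \<in> params" using v by (simp add: params_def)
    ultimately show "t \<in> T_of ` params" by blast
  qed (auto simp: params_def T_of_def Tits_def DerBarK_eq)
qed

lemma T_of_bij_inner: "bij_betw T_of inner_params (lcar (Tits emb \<delta> (Inder emb (jmul \<delta>) Kset)))"
proof (rule bij_betw_imageI)
  show "inj_on T_of inner_params"
    using T_of_inj inner_params_subset by (rule inj_on_subset)
  show "T_of ` inner_params = lcar (Tits emb \<delta> (Inder emb (jmul \<delta>) Kset))"
  proof (intro equalityI subsetI)
    fix t assume "t \<in> lcar (Tits emb \<delta> (Inder emb (jmul \<delta>) Kset))"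
    then obtain m g c where t: "t = (m, K_der (\<lambda>h. 2 * g * \<delta> h) (- \<delta> g) c)" and m: "\<And>i. m i \<in> Kset"
      by (auto simp: Tits_def Inder_K K_inner_def)
    obtain R S where "m = so3_elem R S" using so3_elem_surj[OF m] .
    then have "t = T_of (R, S, - \<epsilon> * c, \<lambda>h. 2 * g * \<delta> h, - \<delta> g)"
      by (simp add: t T_of_def eps_sq)
    moreover have "(R, S, - \<epsilon> * c, \<lambda>h. 2 * g * \<delta> h, - \<delta> g) \<in> inner_params" by (auto simp: inner_params_def)
    ultimately show "t \<in> T_of ` inner_params" by blast
  qed (auto simp: inner_params_def T_of_def Tits_def Inder_K K_innerI)
qed

section \<open>Both parametrizations respect the operations\<close>

lemma so3_elem_ops:
  "so3_elem R S + so3_elem R' S' = so3_elem (R + R') (S + S')"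
  "(\<lambda>i. fscal emb s (so3_elem R S i)) = so3_elem (\<lambda>i. emb s * R i) (\<lambda>i. emb s * S i)"
  "(\<lambda>i. proj p (so3_elem R S i)) = (if p then so3_elem 0 S else so3_elem R 0)"
  by (rule ext, rule Kset_ext; simp add: so3_elem_coords fscal_apply proj_apply algebra_simps)+

lemma J_of_hom:
  assumes "p \<in> params"
  shows "J_of (psmul s p) = (\<lambda>u. fscal emb s (J_of p u))"
    "J_of (ppar b p) = mproj UNIV b (J_of p)"
    "q \<in> params \<Longrightarrow> J_of (padd p q) = J_of p + J_of q"
    "q \<in> params \<Longrightarrow> J_of (pbr p q) = super_comm UNIV (J_of p) (J_of q)"
  using assms
  by (auto simp: params_def J_of_def padd_def pbr_def psmul_def ppar_def J_der_add J_der_bracket J_der_scal J_der_mproj)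

text \<open>\<open>d\<close> is arbitrary: it determines the carrier of \<open>Tits\<close> but not
  the operations, so both isomorphisms can use these identities.\<close>

lemma T_of_hom:
  assumes "p \<in> params"
  shows "T_of (psmul s p) = lsmul (Tits emb \<delta> d) s (T_of p)"
    "T_of (ppar b p) = lpar (Tits emb \<delta> d) b (T_of p)"
    "q \<in> params \<Longrightarrow> T_of (padd p q) = ladd (Tits emb \<delta> d) (T_of p) (T_of q)"
    "q \<in> params \<Longrightarrow> T_of (pbr p q) = lbr (Tits emb \<delta> d) (T_of p) (T_of q)"
proof -
  obtain R S c \<mu> a where p: "p = (R, S, c, \<mu>, a)" and v: "compatible \<mu> a" using assms by (auto simp: params_def)
  show "T_of (psmul s p) = lsmul (Tits emb \<delta> d) s (T_of p)"
    by (simp add: p T_of_def psmul_def Tits_def so3_elem_ops K_der_scal mult.left_commute)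
  show "T_of (ppar b p) = lpar (Tits emb \<delta> d) b (T_of p)"
    by (simp add: p T_of_def ppar_def Tits_def so3_elem_ops K_der_mproj[OF v])
  assume "q \<in> params"
  then obtain R' S' c' \<mu>' a' where q: "q = (R', S', c', \<mu>', a')" and v': "compatible \<mu>' a'" by (auto simp: params_def)
  show "T_of (padd p q) = ladd (Tits emb \<delta> d) (T_of p) (T_of q)"
    by (simp add: p q T_of_def padd_def Tits_def so3_elem_ops K_der_add distrib_left)
  show "T_of (pbr p q) = lbr (Tits emb \<delta> d) (T_of p) (T_of q)"
    unfolding Tits_def lsa.simps p q T_of_def pbr_def prod.case
      Tits_bracket_so3[OF v v'] Tits_bracket_der[OF v v'] ..
qed

lemma params_closed:
  assumes "p \<in> params"
  shows "psmul s p \<in> params" "ppar b p \<in> params"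
    "q \<in> params \<Longrightarrow> padd p q \<in> params" "q \<in> params \<Longrightarrow> pbr p q \<in> params"
  using assms
  by (auto simp: params_def padd_def pbr_def psmul_def ppar_def compatible_add compatible_br compatible_scal compatible_zero)

lemma inner_params_closed:
  assumes "p \<in> inner_params"
  shows "psmul s p \<in> inner_params" "ppar b p \<in> inner_params"
    "q \<in> inner_params \<Longrightarrow> padd p q \<in> inner_params" "q \<in> inner_params \<Longrightarrow> pbr p q \<in> inner_params"
proof -
  obtain R S c g where p: "p = (R, S, c, \<lambda>h. 2 * g * \<delta> h, - \<delta> g)" using assms by (auto simp: inner_params_def)
  have I: "(A, B, e, \<mu>, a) \<in> inner_params" if "\<And>h. \<mu> h = 2 * k * \<delta> h" "a = - \<delta> k" for A B e \<mu> a k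
    using that by (auto simp: inner_params_def)
  show "psmul s p \<in> inner_params"
    unfolding p psmul_def prod.case by (rule I[of _ "emb s * g"]) (auto simp: der_leibniz algebra_simps)
  show "ppar b p \<in> inner_params"
    unfolding p ppar_def prod.case by (auto intro: I[of _ 0] I[of _ g])
  assume "q \<in> inner_params"
  then obtain R' S' c' g' where q: "q = (R', S', c', \<lambda>h. 2 * g' * \<delta> h, - \<delta> g')" by (auto simp: inner_params_def)
  show "padd p q \<in> inner_params"
    unfolding p q padd_def prod.case by (rule I[of _ "g + g'"]) (auto simp: algebra_simps)
  show "pbr p q \<in> inner_params"
    unfolding p q pbr_def prod.case
    \<comment> \<open>\<open>[2 g \<delta>, 2 g' \<delta>] = 4 (g \<delta>(g') - g' \<delta>(g))
      \<delta>\<close>, half of whose coefficient is the first summand; \<open>dotS S S'\<close>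
      comes from the odd parts.\<close>
    by (rule I[of _ "2 * (g * \<delta> g' - g' * \<delta> g) + dotS S S'"])
      (auto simp: br_mu_def br_a_def der_leibniz algebra_simps)
qed

lemma Der_iso: "lsa_iso (maps_lsa emb UNIV (Der emb (jmul \<delta>) UNIV)) (Tits emb \<delta> (DerBarK emb \<delta>))"
  by (rule lsa_iso_of_parametrizations[where f = J_of and g = T_of and P = params
        and pl = padd and bk = pbr and sm = psmul and pr = ppar])
     (auto simp: maps_lsa_def J_of_bij T_of_bij params_closed J_of_hom T_of_hom[where d = "DerBarK emb \<delta>"])

text \<open>The isomorphism is the restriction of the previous one: the same \<open>J_of\<close> and
  \<open>T_of\<close>, now on \<open>inner_params\<close>.\<close>

lemma Inder_iso: "lsa_iso (maps_lsa emb UNIV (Inder emb (jmul \<delta>) UNIV)) (Tits emb \<delta> (Inder emb (jmul \<delta>) Kset))"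
proof -
  note sub = subsetD[OF inner_params_subset]
  show ?thesis
    by (rule lsa_iso_of_parametrizations[where f = J_of and g = T_of and P = inner_params
        and pl = padd and bk = pbr and sm = psmul and pr = ppar])
     (auto simp: maps_lsa_def J_of_bij_inner T_of_bij_inner inner_params_closed sub J_of_hom T_of_hom[where d = "Inder emb (jmul \<delta>) Kset"])
qed

end

theorem theorem7p1:
  fixes emb :: "'f::field \<Rightarrow> 'z::comm_ring_1" and \<delta> :: "'z \<Rightarrow> 'z"
  assumes char: "(2::'f) \<noteq> 0"
    and sqrt_m1: "\<exists>i::'f. i * i = -1"
    and emb_one: "emb 1 = 1"
    and emb_add: "\<forall>a b. emb (a + b) = emb a + emb b"
    and emb_mult: "\<forall>a b. emb (a * b) = emb a * emb b"
    and der_add: "\<forall>a b. \<delta> (a + b) = \<delta> a + \<delta> b"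
    and der_scal: "\<forall>c a. \<delta> (emb c * a) = emb c * \<delta> a"
    and der_leibniz: "\<forall>a b. \<delta> (a * b) = a * \<delta> b + \<delta> a * b"
    and span: "\<forall>z. \<exists>(n::nat) fs gs. z = (\<Sum>i<n. fs i * \<delta> (gs i))"
  shows "lsa_iso (maps_lsa emb UNIV (Der emb (jmul \<delta>) UNIV)) (Tits emb \<delta> (DerBarK emb \<delta>))
       \<and> lsa_iso (maps_lsa emb UNIV (Inder emb (jmul \<delta>) UNIV))
                 (Tits emb \<delta> (Inder emb (jmul \<delta>) Kset))"
proof -
  obtain \<iota> :: 'f where "\<iota> * \<iota> = -1" using sqrt_m1 by blast
  then interpret cheng_kac emb \<delta> \<iota>
    using assms by unfold_locales (blast+)
  show ?thesis using Der_iso Inder_iso by blast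
qed

end
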